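(* Let $p>3$ be a prime, and let $a$ be a $p$-adic integer. (i) If $m$ is a positive integer with $a\equiv m\pmod{p^2}$, then $$\sum_{k=0}^{p-1}\binom{-a}k\binom{a-1}kH_k^{(2)}\equiv 2\sum_{\substack{0<k<m\\ p\nmid k}}\frac{(-1)^{m-k}}{k^2}\equiv-E_{p^2-p-2}(a)\pmod{p^2}$$ and $$(2a-1)\sum_{k=0}^{p-1}\binom{-a}k\binom{a-1}k\frac{H_k^{(2)}}{2k+1}\equiv-2\sum_{\substack{0<k<m\\ p\nmid k}}\frac1{k^2}\equiv(2-2p)B_{p^2-p-1}(a)\pmod{p^2}.$$ (ii) We always have $$\sum_{k=0}^{p-1}\binom{-a}k\binom{a-1}kH_k^{(2)}\equiv -E_{p-3}(a)\pmod p$$ and $$(2a-1)\sum_{k=0}^{p-1}\binom{-a}k\binom{a-1}k\frac{H_k^{(2)}}{2k+1}\equiv B_{p-2}(a)\pmod p.$$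
   Context: For $n\in\mathbb N=\{0,1,2,\ldots\}$, $H_n^{(2)}=\sum_{0<k\le n}\frac1{k^2}$ is the second-order harmonic number (so $H_0^{(2)}=0$). $B_0,B_1,\ldots$ are the Bernoulli numbers (with $B_1=-\frac12$) and $B_n(x)=\sum_{k=0}^n\binom nkB_kx^{n-k}$ is the Bernoulli polynomial of degree $n$. $E_0,E_1,\ldots$ are the Euler numbers and $E_n(x)=\sum_{k=0}^n\binom nk\frac{E_k}{2^k}\left(x-\frac12\right)^{n-k}$ is the Euler polynomial of degree $n$. $\binom{x}{k}=\frac{x(x-1)\cdots(x-k+1)}{k!}$ is the generalized binomial coefficient. Congruences modulo $p^j$ are in the ring $\mathbb Z_p$ of $p$-adic integers. (Since $H_{(p-1)/2}^{(2)}\equiv0\pmod p$, the number $H_k^{(2)}/(2k+1)$ is a $p$-adic integer for every $k=0,1,\ldots,p-1$.) Empty sums are $0$. *)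

theory Defs
  imports "HOL-Computational_Algebra.Computational_Algebra" "Berlekamp_Zassenhaus.Finite_Field"
begin

section \<open>The \<open>p\<close>-adic integers and the \<open>p\<close>-adic numbers\<close>

text \<open>
  The prime \<open>p\<close> is the cardinality of the index type \<open>'p\<close>. The \<open>p\<close>-adic integers are the inverse
  limit of the rings \<open>Z/p^n\<close>: the \<open>n\<close>-th entry of a coherent sequence is its residue modulo \<open>p^n\<close>,
  represented in \<open>{0..<p^n}\<close> (the range is forced by the coherence condition). The \<open>p\<close>-adic numbers
  are the fraction field of this domain.
\<close>

typedef ('p::prime_card) padic_int =
  "{f :: nat \<Rightarrow> int. \<forall>n. f (Suc n) mod int CARD('p) ^ n = f n}"
  morphisms padic_residue Abs_padic_int
  by (rule exI[of _ "\<lambda>_. 0"]) simp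

setup_lifting type_definition_padic_int

lemma mod_power_Suc_mod: "(x mod (p * p ^ n)) mod p ^ n = x mod (p :: int) ^ n"
  by (rule mod_mod_cancel) simp

lemma mod_cong_ops:
  fixes a b :: int
  assumes "a mod q = a'" "b mod q = b'"
  shows "(- a) mod q = (- a') mod q" "(a + b) mod q = (a' + b') mod q"
    "(a - b) mod q = (a' - b') mod q" "(a * b) mod q = (a' * b') mod q"
  unfolding assms[symmetric] by (simp_all add: mod_simps)

instantiation padic_int :: (prime_card) comm_ring_1
begin

lift_definition zero_padic_int :: "'a padic_int" is "\<lambda>_. 0" by simp

lift_definition one_padic_int :: "'a padic_int" is "\<lambda>n. 1 mod int CARD('a) ^ n"
  by (simp add: mod_power_Suc_mod)

lift_definition uminus_padic_int :: "'a padic_int \<Rightarrow> 'a padic_int"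
  is "\<lambda>f n. (- f n) mod int CARD('a) ^ n"
  by (simp only: power_Suc mod_power_Suc_mod, rule mod_cong_ops(1)[where b=0]; simp)

lift_definition plus_padic_int :: "'a padic_int \<Rightarrow> 'a padic_int \<Rightarrow> 'a padic_int"
  is "\<lambda>f g n. (f n + g n) mod int CARD('a) ^ n"
  by (simp only: power_Suc mod_power_Suc_mod, rule mod_cong_ops(2); simp)

lift_definition minus_padic_int :: "'a padic_int \<Rightarrow> 'a padic_int \<Rightarrow> 'a padic_int"
  is "\<lambda>f g n. (f n - g n) mod int CARD('a) ^ n"
  by (simp only: power_Suc mod_power_Suc_mod, rule mod_cong_ops(3); simp)

lift_definition times_padic_int :: "'a padic_int \<Rightarrow> 'a padic_int \<Rightarrow> 'a padic_int"
  is "\<lambda>f g n. (f n * g n) mod int CARD('a) ^ n"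
  by (simp only: power_Suc mod_power_Suc_mod, rule mod_cong_ops(4); simp)

lemma padic_coherent_mod:
  assumes "\<forall>n. f (Suc n) mod int CARD('a) ^ n = f n"
  shows "f n mod int CARD('a) ^ n = f n"
  by (subst assms[rule_format, symmetric], subst mod_mod_trivial) (simp add: assms)

instance
proof
  fix a b c :: "'a padic_int"
  show "a * b * c = a * (b * c)"
    by transfer (simp add: mod_simps mult.assoc)
  show "a * b = b * a"
    by transfer (simp add: mult.commute)
  show "1 * a = a"
    by transfer (simp add: mod_simps padic_coherent_mod fun_eq_iff)
  show "a + b + c = a + (b + c)"
    by transfer (simp add: mod_simps add.assoc)
  show "a + b = b + a"
    by transfer (simp add: add.commute)
  show "0 + a = a"
    by transfer (simp add: padic_coherent_mod fun_eq_iff)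
  show "- a + a = 0"
    by transfer (simp add: mod_simps)
  show "a - b = a + - b"
    by transfer (simp add: mod_simps)
  show "(a + b) * c = a * c + b * c"
    by transfer (simp add: mod_simps distrib_right)
  show "(0 :: 'a padic_int) \<noteq> 1"
  proof
    assume "(0 :: 'a padic_int) = 1"
    then have "(\<lambda>_. 0) = (\<lambda>n. 1 mod int CARD('a) ^ n)"
      by transfer
    then have "0 = 1 mod int CARD('a) ^ 1"
      by metis
    then show False
      using prime_gt_1_nat[OF prime_card[where 'a='a]] by simp
  qed
qed

end

lemma padic_residue_coherent:
  "padic_residue x n = padic_residue x (n + k) mod int CARD('p) ^ n"
  for x :: "'p::prime_card padic_int"
proof (induction k)
  case 0
  show ?case
    using padic_residue[of x] by (simp add: padic_coherent_mod)
next
  case (Suc k)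
  have "padic_residue x (n + Suc k) mod int CARD('p) ^ (n + k) = padic_residue x (n + k)"
    using padic_residue[of x] by simp
  moreover have "(y mod int CARD('p) ^ (n + k)) mod int CARD('p) ^ n = y mod int CARD('p) ^ n" for y
    by (rule mod_mod_cancel) (simp add: le_imp_power_dvd)
  ultimately show ?case
    using Suc by metis
qed

lemma padic_int_eq_0_iff: "x = 0 \<longleftrightarrow> (\<forall>n. padic_residue x n = 0)"
  by transfer auto

lemma padic_residue_of_nat:
  "padic_residue (of_nat k :: 'p::prime_card padic_int) n = int k mod int CARD('p) ^ n"
  by (induction k) (simp_all add: zero_padic_int.rep_eq one_padic_int.rep_eq
      plus_padic_int.rep_eq mod_simps)

instance padic_int :: (prime_card) idom
proof
  fix x y :: "'a padic_int"
  let ?p = "int CARD('a)"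
  assume "x \<noteq> 0" "y \<noteq> 0"
  then obtain i j where ij: "padic_residue x i \<noteq> 0" "padic_residue y j \<noteq> 0"
    unfolding padic_int_eq_0_iff by blast
  define u where "u = padic_residue x (i + j)"
  define v where "v = padic_residue y (i + j)"
  have u: "\<not> ?p ^ i dvd u"
    using ij(1) padic_residue_coherent[of x i j] by (auto simp: u_def)
  have v: "\<not> ?p ^ j dvd v"
    using ij(2) padic_residue_coherent[of y j i] by (auto simp: v_def add.commute)
  have p: "prime ?p"
    using prime_card by simp
  have uv0: "u \<noteq> 0" "v \<noteq> 0"
    using u v by auto
  have "multiplicity ?p u < i" "multiplicity ?p v < j"
    using u v by (meson multiplicity_dvd' not_le)+
  then have "multiplicity ?p (u * v) < i + j"
    using p uv0 by (subst prime_elem_multiplicity_mult_distrib) auto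
  then have "\<not> ?p ^ (i + j) dvd u * v"
    using p uv0 by (subst power_dvd_iff_le_multiplicity) auto
  then have "padic_residue (x * y) (i + j) \<noteq> 0"
    by (auto simp: times_padic_int.rep_eq u_def v_def mod_eq_0_iff_dvd)
  then show "x * y \<noteq> 0"
    unfolding padic_int_eq_0_iff by blast
qed

instance padic_int :: (prime_card) ring_char_0
proof
  show "inj (of_nat :: nat \<Rightarrow> 'a padic_int)"
  proof (rule injI)
    fix k l :: nat
    assume "(of_nat k :: 'a padic_int) = of_nat l"
    then have eq: "int k mod int CARD('a) ^ (k + l) = int l mod int CARD('a) ^ (k + l)"
      by (metis padic_residue_of_nat)
    have "k + l < CARD('a) ^ (k + l)"
      using prime_gt_1_nat[OF prime_card[where 'a='a]] by (intro power_gt_expt) simp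
    then have "int (k + l) < int CARD('a) ^ (k + l)"
      by (metis of_nat_less_iff of_nat_power)
    then have "int k mod int CARD('a) ^ (k + l) = int k" "int l mod int CARD('a) ^ (k + l) = int l"
      by (intro mod_pos_pos_trivial; linarith)+
    then show "k = l"
      using eq by simp
  qed
qed

instance fract :: ("{idom, ring_char_0}") field_char_0
proof
  show "inj (of_nat :: nat \<Rightarrow> 'a fract)"
    by (rule injI) (simp add: of_nat_fract eq_fract)
qed

type_synonym 'p padic = "'p padic_int fract"

definition padic_Ints :: "'p::prime_card padic set"
  where "padic_Ints = range to_fract"

text \<open>
  A congruence modulo \<open>p^j\<close> takes place in the ring of \<open>p\<close>-adic integers, so it includes the claim
  that both sides lie there. In the notation only \<open>j\<close> is an argument; the prime is \<open>CARD('p)\<close>.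
\<close>

definition padic_cong :: "'p::prime_card padic \<Rightarrow> 'p padic \<Rightarrow> nat \<Rightarrow> bool"
  (\<open>(\<open>indent=1\<close>[_ = _] '(mod'_p^_'))\<close>)
  where "[x = y] (mod_p^j) \<longleftrightarrow>
    x \<in> padic_Ints \<and> y \<in> padic_Ints \<and> (\<exists>z\<in>padic_Ints. x - y = of_nat CARD('p) ^ j * z)"


section \<open>Harmonic, Bernoulli and Euler numbers and polynomials\<close>

definition harm2 :: "nat \<Rightarrow> 'a::field_char_0"
  where "harm2 n = (\<Sum>k\<in>{0<..n}. 1 / of_nat k ^ 2)"

text \<open>The exponential generating function \<open>t / (e^t - 1)\<close> gives the convention \<open>B_1 = -1/2\<close>.\<close>

definition bernoulli :: "nat \<Rightarrow> rat"
  where "bernoulli n = fact n * fps_nth (fps_X / (fps_exp 1 - 1)) n"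

text \<open>The exponential generating function of the Euler numbers is \<open>2 / (e^t + e^(-t))\<close>.\<close>

definition euler_num :: "nat \<Rightarrow> rat"
  where "euler_num n = fact n * fps_nth (2 / (fps_exp 1 + fps_exp (- 1))) n"

definition bernoulli_poly :: "nat \<Rightarrow> 'a::field_char_0 \<Rightarrow> 'a"
  where "bernoulli_poly n x = (\<Sum>k\<le>n. of_nat (n choose k) * of_rat (bernoulli k) * x ^ (n - k))"

definition euler_poly :: "nat \<Rightarrow> 'a::field_char_0 \<Rightarrow> 'a"
  where "euler_poly n x =
    (\<Sum>k\<le>n. of_nat (n choose k) * (of_rat (euler_num k) / 2 ^ k) * (x - 1 / 2) ^ (n - k))"

end

theory Submission
  imports Defs "HOL-Number_Theory.Residues" "HOL-Number_Theory.Modular_Inverse"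
begin

text \<open>
  Write \<open>f\<^sub>k(x)\<close> for the product of the two binomial coefficients and
  \<open>g\<^sub>k(x) = \<Prod>\<^sub>i\<^sub>\<le>\<^sub>k (1 - x\<^sup>2 / i\<^sup>2)\<close>. Both \<open>f\<^sub>k(x + 1) + f\<^sub>k(x)\<close> and
  \<open>((2x + 1) f\<^sub>k(x + 1) - (2x - 1) f\<^sub>k(x)) / (2k + 1)\<close> equal \<open>2 (g\<^sub>k(x) - g\<^sub>k\<^sub>-\<^sub>1(x))\<close>. Summation by
  parts against the harmonic numbers therefore shows that \<open>S(x + 1) + S(x) = T(x + 1) - T(x)\<close> for
  the first sum \<open>S\<close> and the second sum \<open>T\<close> (with its factor \<open>2x - 1\<close>); modulo \<open>p\<^sup>2\<close> this is
  \<open>- 2 / x\<^sup>2\<close> at a natural number \<open>x\<close> prime to \<open>p\<close> and \<open>0\<close> at a multiple of \<open>p\<close>.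
  By Euler's theorem the Euler and Bernoulli
  polynomials satisfy the same difference equations modulo \<open>p\<^sup>2\<close>, since \<open>p\<^sup>2 - p\<close> is the totient of
  \<open>p\<^sup>2\<close>; all quantities vanish at \<open>1\<close>, so they agree at positive integers. They are polynomials in \<open>a\<close>,
  hence p-adically continuous, and the positive integers are dense in the p-adic integers; continuity
  replaces any discussion of the integrality of their coefficients.
\<close>

section \<open>Arithmetic of the p-adic integers\<close>

lemma padic_residue_range:
  "0 \<le> padic_residue x n" "padic_residue x n < int CARD('p) ^ n"
  for x :: "'p::prime_card padic_int"
proof -
  have q: "padic_residue x n = padic_residue x n mod int CARD('p) ^ n"
    using padic_residue_coherent[of x n 0] by simp
  have "int CARD('p) ^ n > 0" by simp
  then show "0 \<le> padic_residue x n" "padic_residue x n < int CARD('p) ^ n"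
    by (subst q, simp)+
qed

text \<open>The quotient is the residue sequence shifted by \<open>n\<close> places with every entry
  divided by \<open>p^n\<close>; coherence with the vanishing \<open>n\<close>-th residue makes
  these divisions exact.\<close>

lemma padic_int_dvd_if_residue_0:
  fixes x :: "'p::prime_card padic_int"
  assumes "padic_residue x n = 0"
  shows "of_nat (CARD('p) ^ n) dvd x"
proof -
  let ?p = "int CARD('p)"
  define r where "r = padic_residue x"
  define y where "y = (Abs_padic_int (\<lambda>k. r (n + k) div ?p ^ n) :: 'p padic_int)"
  have dvd: "?p ^ n dvd r (n + k)" for k
    using padic_residue_coherent[of x n k] assms by (auto simp: r_def)
  have coh: "(r (n + Suc k) div ?p ^ n) mod ?p ^ k = r (n + k) div ?p ^ n" for k
  proof -
    obtain t where t: "r (n + Suc k) = ?p ^ n * t"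
      using dvd by blast
    have "r (n + k) = r (n + Suc k) mod ?p ^ (n + k)"
      using padic_residue_coherent[of x "n + k" 1] by (simp add: r_def)
    also have "\<dots> = ?p ^ n * (t mod ?p ^ k)"
      unfolding t power_add by (simp only: mod_mult_mult1)
    finally show ?thesis using t by simp
  qed
  have res: "padic_residue y = (\<lambda>k. r (n + k) div ?p ^ n)"
    unfolding y_def by (rule Abs_padic_int_inverse) (use coh in simp)
  have "padic_residue (of_nat (CARD('p) ^ n) * y) k = padic_residue x k" for k
  proof -
    have "padic_residue (of_nat (CARD('p) ^ n) * y) k
          = (?p ^ n * (r (n + k) div ?p ^ n)) mod ?p ^ k"
      unfolding times_padic_int.rep_eq res padic_residue_of_nat by (simp add: mod_simps)
    also have "\<dots> = r (n + k) mod ?p ^ k"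
      using dvd by simp
    also have "\<dots> = padic_residue x k"
      using padic_residue_coherent[of x k n] by (simp add: r_def add.commute)
    finally show ?thesis .
  qed
  then have "of_nat (CARD('p) ^ n) * y = x"
    by (metis padic_residue_inject ext)
  then show ?thesis by (metis dvd_triv_left)
qed

text \<open>Density of the naturals: an element and its own \<open>n\<close>-th residue, read as a
  natural number, have the same residue modulo \<open>p^n\<close>.\<close>

lemma padic_int_approx:
  fixes x :: "'p::prime_card padic_int"
  shows "of_nat (CARD('p) ^ n) dvd x - of_nat (nat (padic_residue x n))"
proof (rule padic_int_dvd_if_residue_0)
  have "int (nat (padic_residue x n)) mod int CARD('p) ^ n = padic_residue x n"
    using padic_residue_range[of x n] by simp
  then show "padic_residue (x - of_nat (nat (padic_residue x n))) n = 0"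
    by (simp add: minus_padic_int.rep_eq padic_residue_of_nat)
qed

text \<open>The inverse is assembled from inverses modulo each \<open>p^k\<close>. A nonzero first
  residue makes every residue coprime to p, and uniqueness of inverses modulo \<open>p^k\<close>
  gives coherence.\<close>

lemma padic_int_unit:
  fixes x :: "'p::prime_card padic_int"
  assumes "padic_residue x 1 \<noteq> 0"
  shows "x dvd 1"
proof -
  let ?p = "int CARD('p)"
  define r where "r = padic_residue x"
  define y where "y = (Abs_padic_int (\<lambda>k. modular_inverse (?p ^ k) (r k)) :: 'p padic_int)"
  have p: "prime ?p" using prime_card by simp
  have cop: "coprime (r k) (?p ^ k)" for k
  proof (cases k)
    case (Suc l)
    have "r 1 = r k mod ?p"
      using padic_residue_coherent[of x 1 l] by (simp add: r_def Suc)
    then have "\<not> ?p dvd r k"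
      using assms by (auto simp: r_def)
    then have "coprime ?p (r k)"
      using p by (simp add: prime_imp_coprime)
    then show ?thesis
      by (simp add: coprime_commute)
  qed simp
  have range: "0 \<le> modular_inverse (?p ^ k) (r k)" "modular_inverse (?p ^ k) (r k) < ?p ^ k" for k
    by (simp_all add: modular_inverse_int_nonneg modular_inverse_int_less)
  have coh: "modular_inverse (?p ^ Suc k) (r (Suc k)) mod ?p ^ k = modular_inverse (?p ^ k) (r k)" for k
  proof -
    let ?i = "modular_inverse (?p ^ Suc k) (r (Suc k))"
    have "[r (Suc k) * ?i = 1] (mod ?p ^ Suc k)"
      using cop by (rule cong_modular_inverse1)
    then have 1: "[r (Suc k) * ?i = 1] (mod ?p ^ k)"
      by (rule cong_dvd_modulus) simp
    have "[r k = r (Suc k)] (mod ?p ^ k)"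
      using padic_residue_coherent[of x k 1] by (simp add: r_def cong_def)
    then have "[r k * ?i = r (Suc k) * ?i] (mod ?p ^ k)"
      by (rule cong_scalar_right)
    then have "[r k * ?i = 1] (mod ?p ^ k)"
      using 1 cong_trans by blast
    moreover have "[r k * modular_inverse (?p ^ k) (r k) = 1] (mod ?p ^ k)"
      using cop by (rule cong_modular_inverse1)
    ultimately have "[r k * ?i = r k * modular_inverse (?p ^ k) (r k)] (mod ?p ^ k)"
      using cong_sym cong_trans by blast
    then have "[?i = modular_inverse (?p ^ k) (r k)] (mod ?p ^ k)"
      using cop by (simp add: cong_mult_lcancel)
    then show ?thesis
      using range[of k] by (simp add: cong_def)
  qed
  have res: "padic_residue y = (\<lambda>k. modular_inverse (?p ^ k) (r k))"
    unfolding y_def by (rule Abs_padic_int_inverse) (use coh in simp)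
  have "padic_residue (x * y) k = padic_residue (1 :: 'p padic_int) k" for k
    using cong_modular_inverse1[OF cop[of k]]
    by (simp add: times_padic_int.rep_eq one_padic_int.rep_eq res r_def cong_def)
  then have "x * y = 1"
    by (metis padic_residue_inject ext)
  then show ?thesis by (metis dvd_triv_left)
qed

text \<open>If the first residue vanishes, a factor p splits off and a nonzero residue moves one
  place down; otherwise the element is a unit. This bounds denominators in the fraction
  field.\<close>

lemma padic_int_dvd_prime_power:
  fixes x :: "'p::prime_card padic_int"
  assumes "x \<noteq> 0"
  obtains n where "x dvd of_nat (CARD('p) ^ n)"
proof -
  obtain k where "padic_residue x k \<noteq> 0"
    using assms unfolding padic_int_eq_0_iff by blast
  then have "\<exists>n. x dvd of_nat (CARD('p) ^ n)"
  proof (induction k arbitrary: x)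
    case 0
    then show ?case using padic_residue_range[of x 0] by simp
  next
    case (Suc k)
    show ?case
    proof (cases "padic_residue x 1 = 0")
      case True
      then have "of_nat (CARD('p) ^ 1) dvd x"
        by (rule padic_int_dvd_if_residue_0)
      then obtain y where y: "x = of_nat CARD('p) * y" by auto
      have "padic_residue y k \<noteq> 0"
      proof
        assume "padic_residue y k = 0"
        then have "of_nat (CARD('p) ^ k) dvd y"
          by (rule padic_int_dvd_if_residue_0)
        then obtain z where "x = of_nat (CARD('p) ^ Suc k) * z"
          using y by (auto simp: mult.assoc)
        then have "padic_residue x (Suc k) = 0"
          by (simp add: times_padic_int.rep_eq padic_residue_of_nat del: power_Suc of_nat_power)
            (simp del: power_Suc)
        then show False using Suc.prems by simp
      qed
      then obtain n where "y dvd of_nat (CARD('p) ^ n)"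
        using Suc.IH by blast
      then have "x dvd of_nat (CARD('p) ^ Suc n)"
        unfolding y by (simp add: mult_dvd_mono)
      then show ?thesis by blast
    next
      case False
      then have "x dvd of_nat (CARD('p) ^ 0)"
        using padic_int_unit by simp
      then show ?thesis by blast
    qed
  qed
  then show ?thesis using that by blast
qed


section \<open>Integral elements of the field of p-adic numbers\<close>

lemma to_fract_of_nat: "to_fract (of_nat n) = of_nat n"
  by (induction n) auto

lemma padic_Ints_closed [simp, intro]:
  fixes x y :: "'p::prime_card padic"
  shows "0 \<in> (padic_Ints :: 'p padic set)" "1 \<in> (padic_Ints :: 'p padic set)"
    "of_nat n \<in> (padic_Ints :: 'p padic set)" "numeral w \<in> (padic_Ints :: 'p padic set)"
    "x \<in> padic_Ints \<Longrightarrow> - x \<in> padic_Ints"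
    "x \<in> padic_Ints \<Longrightarrow> y \<in> padic_Ints \<Longrightarrow> x + y \<in> padic_Ints"
    "x \<in> padic_Ints \<Longrightarrow> y \<in> padic_Ints \<Longrightarrow> x - y \<in> padic_Ints"
    "x \<in> padic_Ints \<Longrightarrow> y \<in> padic_Ints \<Longrightarrow> x * y \<in> padic_Ints"
proof -
  show "of_nat n \<in> (padic_Ints :: 'p padic set)" for n
    unfolding padic_Ints_def by (metis to_fract_of_nat rangeI)
  from this[of 0] this[of 1] this[of "numeral w"]
  show "0 \<in> (padic_Ints :: 'p padic set)" "1 \<in> (padic_Ints :: 'p padic set)"
    "numeral w \<in> (padic_Ints :: 'p padic set)"
    by simp_all
  show "x \<in> padic_Ints \<Longrightarrow> - x \<in> padic_Ints"
    "x \<in> padic_Ints \<Longrightarrow> y \<in> padic_Ints \<Longrightarrow> x + y \<in> padic_Ints"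
    "x \<in> padic_Ints \<Longrightarrow> y \<in> padic_Ints \<Longrightarrow> x - y \<in> padic_Ints"
    "x \<in> padic_Ints \<Longrightarrow> y \<in> padic_Ints \<Longrightarrow> x * y \<in> padic_Ints"
    unfolding padic_Ints_def
    by (auto simp flip: to_fract_add to_fract_diff to_fract_mult to_fract_uminus)
qed

lemma padic_Ints_power [simp, intro]: "x \<in> padic_Ints \<Longrightarrow> x ^ n \<in> padic_Ints"
  by (induction n) auto

lemma padic_Ints_sum [intro]: "(\<And>i. i \<in> A \<Longrightarrow> f i \<in> padic_Ints) \<Longrightarrow> sum f A \<in> padic_Ints"
  by (induction A rule: infinite_finite_induct) auto

lemma padic_Ints_prod [intro]: "(\<And>i. i \<in> A \<Longrightarrow> f i \<in> padic_Ints) \<Longrightarrow> prod f A \<in> padic_Ints"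
  by (induction A rule: infinite_finite_induct) auto

lemma padic_Ints_inverse_of_nat:
  assumes "\<not> CARD('p) dvd k"
  shows "1 / of_nat k \<in> (padic_Ints :: 'p::prime_card padic set)"
proof -
  have "padic_residue (of_nat k :: 'p padic_int) 1 \<noteq> 0"
    using assms by (simp add: padic_residue_of_nat flip: of_nat_mod) (simp add: dvd_eq_mod_eq_0)
  then obtain y :: "'p padic_int" where "1 = of_nat k * y"
    using padic_int_unit by blast
  then have "to_fract (of_nat k * y) = 1"
    by simp
  then have "of_nat k * to_fract y = 1"
    by (simp add: to_fract_of_nat)
  then have "1 / of_nat k = to_fract y"
    by (metis divide_eq_eq mult.commute mult_zero_left zero_neq_one)
  then show ?thesis
    by (simp add: padic_Ints_def)
qed

text \<open>Polynomial values and coefficients may have p in the denominator; clearing it by a power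
  of p is what continuity of products requires.\<close>

lemma padic_denominator:
  fixes x :: "'p::prime_card padic"
  obtains n where "of_nat CARD('p) ^ n * x \<in> padic_Ints"
proof -
  obtain u v where x: "x = to_fract u / to_fract v" and v: "v \<noteq> 0"
    by (cases x) (auto simp: Fract_conv_to_fract)
  obtain n y where "of_nat (CARD('p) ^ n) = v * y"
    using padic_int_dvd_prime_power[OF v] by (meson dvdE)
  then have "to_fract (of_nat (CARD('p) ^ n)) = to_fract v * to_fract y"
    by simp
  then have "of_nat CARD('p) ^ n = to_fract v * to_fract y"
    unfolding to_fract_of_nat by simp
  then have "of_nat CARD('p) ^ n * x = to_fract (y * u)"
    using v by (simp add: x)
  then show ?thesis
    using that by (metis padic_Ints_def rangeI)
qed

lemma padic_Ints_approx:
  fixes x :: "'p::prime_card padic"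
  assumes "x \<in> padic_Ints"
  obtains k z where "z \<in> padic_Ints" "x - of_nat k = of_nat CARD('p) ^ n * z"
proof -
  obtain y where x: "x = to_fract y"
    using assms by (auto simp: padic_Ints_def)
  obtain z k where "y - of_nat k = of_nat (CARD('p) ^ n) * z"
    using padic_int_approx[of n y] by (meson dvdE)
  then have "to_fract (y - of_nat k) = to_fract (of_nat (CARD('p) ^ n) * z)"
    by simp
  then have "x - of_nat k = of_nat CARD('p) ^ n * to_fract z"
    unfolding x to_fract_diff to_fract_mult to_fract_of_nat by simp
  then show ?thesis
    using that by (metis padic_Ints_def rangeI)
qed


section \<open>Congruences and continuity\<close>

text \<open>Integrality is assumed on one side only and passes to \<open>x\<close> through the
  difference. This is how values of the polynomials at a limit point are later seen to be
  integral.\<close>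

lemma padic_congI:
  fixes x y :: "'p::prime_card padic"
  assumes "y \<in> padic_Ints" "z \<in> padic_Ints" "x - y = of_nat CARD('p) ^ j * z"
  shows "[x = y] (mod_p^j)"
proof -
  have "x = y + of_nat CARD('p) ^ j * z"
    using assms(3) by (simp add: algebra_simps)
  then show ?thesis
    unfolding padic_cong_def using assms by auto
qed

lemma padic_congE:
  fixes x y :: "'p::prime_card padic"
  assumes "[x = y] (mod_p^j)"
  obtains z where "z \<in> padic_Ints" "x = y + of_nat CARD('p) ^ j * z"
  using assms by (auto simp: padic_cong_def algebra_simps)

lemma padic_cong_refl [simp]: "x \<in> padic_Ints \<Longrightarrow> [x = x] (mod_p^j)"
  by (rule padic_congI[of _ 0]) auto

lemma padic_cong_sym: "[x = y] (mod_p^j) \<Longrightarrow> [y = x] (mod_p^j)"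
  using padic_congI[of x "- z" y j for z] by (auto simp: padic_cong_def algebra_simps)

lemma padic_cong_trans [trans]:
  assumes "[x = y] (mod_p^j)" "[y = z] (mod_p^j)"
  shows "[x = z] (mod_p^j)"
proof -
  obtain u v where "u \<in> padic_Ints" "x = y + of_nat CARD('a) ^ j * u"
    "v \<in> padic_Ints" "y = z + of_nat CARD('a) ^ j * v"
    using assms by (auto elim!: padic_congE)
  then show ?thesis
    using assms by (intro padic_congI[of _ "u + v"]) (auto simp: padic_cong_def algebra_simps)
qed

lemma padic_cong_weaken:
  fixes x y :: "'p::prime_card padic"
  assumes "[x = y] (mod_p^j)" "i \<le> j"
  shows "[x = y] (mod_p^i)"
proof -
  obtain u where "u \<in> padic_Ints" "x = y + of_nat CARD('p) ^ j * u"
    using assms by (auto elim!: padic_congE)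
  moreover have "j = i + (j - i)"
    using assms by simp
  ultimately show ?thesis
    using assms
    by (intro padic_congI[of _ "of_nat CARD('p) ^ (j - i) * u"])
      (auto simp: padic_cong_def mult.assoc[symmetric] power_add[symmetric])
qed

lemma padic_cong_add:
  assumes "[x = y] (mod_p^j)" "[x' = y'] (mod_p^j)"
  shows "[x + x' = y + y'] (mod_p^j)"
proof -
  obtain u v where "u \<in> padic_Ints" "x = y + of_nat CARD('a) ^ j * u"
    "v \<in> padic_Ints" "x' = y' + of_nat CARD('a) ^ j * v"
    using assms by (auto elim!: padic_congE)
  then show ?thesis
    using assms by (intro padic_congI[of _ "u + v"]) (auto simp: padic_cong_def algebra_simps)
qed

lemma padic_cong_mult:
  assumes "[x = y] (mod_p^j)" "[x' = y'] (mod_p^j)"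
  shows "[x * x' = y * y'] (mod_p^j)"
proof -
  obtain u v where uv: "u \<in> padic_Ints" "x = y + of_nat CARD('a) ^ j * u"
    "v \<in> padic_Ints" "x' = y' + of_nat CARD('a) ^ j * v"
    using assms by (auto elim!: padic_congE)
  have "x' \<in> padic_Ints" "y \<in> padic_Ints" "y' \<in> padic_Ints"
    using assms by (auto simp: padic_cong_def)
  then show ?thesis
    using uv by (intro padic_congI[of _ "u * x' + y * v"]) (auto simp: algebra_simps)
qed

lemma padic_cong_uminus:
  assumes "[x = y] (mod_p^j)"
  shows "[- x = - y] (mod_p^j)"
  using padic_cong_mult[OF padic_cong_refl[of "-1"] assms] by auto

lemma padic_cong_diff:
  assumes "[x = y] (mod_p^j)" "[x' = y'] (mod_p^j)"
  shows "[x - x' = y - y'] (mod_p^j)"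
  using padic_cong_add[OF assms(1) padic_cong_uminus[OF assms(2)]] by simp

lemma padic_cong_sum:
  "(\<And>i. i \<in> A \<Longrightarrow> [f i = g i] (mod_p^j)) \<Longrightarrow> [sum f A = sum g A] (mod_p^j)"
  by (induction A rule: infinite_finite_induct) (auto intro: padic_cong_add)

lemma padic_cong_power: "[x = y] (mod_p^j) \<Longrightarrow> [x ^ n = y ^ n] (mod_p^j)"
  by (induction n) (auto intro: padic_cong_mult)

lemma padic_cong_of_nat:
  assumes "[a = b] (mod CARD('p) ^ j)"
  shows "[of_nat a = (of_nat b :: 'p::prime_card padic)] (mod_p^j)"
proof -
  have *: "[of_nat a = (of_nat b :: 'p padic)] (mod_p^j)"
    if ab: "b \<le> a" "[a = b] (mod CARD('p) ^ j)" for a b :: nat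
  proof -
    obtain q where "a = b + CARD('p) ^ j * q"
      using cong_le_nat[OF ab(1)] ab(2) by (auto simp: mult.commute)
    then show ?thesis
      by (intro padic_congI[of _ "of_nat q"]) auto
  qed
  show ?thesis
  proof (cases "b \<le> a")
    case True
    then show ?thesis using assms by (rule *)
  next
    case False
    then have "[of_nat b = (of_nat a :: 'p padic)] (mod_p^j)"
      using *[OF _ cong_sym[OF assms]] by simp
    then show ?thesis by (rule padic_cong_sym)
  qed
qed

section \<open>Continuity for the p-adic topology\<close>

text \<open>The neighbourhoods lie in the p-adic integers, but the values need not: only their
  difference must be divisible, so polynomials with nonintegral coefficients are covered.\<close>

definition padic_continuous :: "('p::prime_card padic \<Rightarrow> 'p padic) \<Rightarrow> 'p padic \<Rightarrow> bool"
  where "padic_continuous F a \<longleftrightarrow>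
    (\<forall>j. \<exists>n. \<forall>b. [b = a] (mod_p^n) \<longrightarrow> (\<exists>z\<in>padic_Ints. F b - F a = of_nat CARD('p) ^ j * z))"

lemma padic_continuous_const: "padic_continuous (\<lambda>_. c) a"
  unfolding padic_continuous_def by (auto intro!: bexI[of _ 0])

lemma padic_continuous_id: "padic_continuous (\<lambda>x. x) a"
  unfolding padic_continuous_def padic_cong_def by blast

lemma padic_continuous_add:
  fixes a :: "'p::prime_card padic"
  assumes "padic_continuous F a" "padic_continuous G a"
  shows "padic_continuous (\<lambda>x. F x + G x) a"
  unfolding padic_continuous_def
proof
  fix j
  obtain m n where
    m: "\<And>b. [b = a] (mod_p^m) \<Longrightarrow> \<exists>z\<in>padic_Ints. F b - F a = of_nat CARD('p) ^ j * z" and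
    n: "\<And>b. [b = a] (mod_p^n) \<Longrightarrow> \<exists>z\<in>padic_Ints. G b - G a = of_nat CARD('p) ^ j * z"
    using assms unfolding padic_continuous_def by metis
  show "\<exists>n. \<forall>b. [b = a] (mod_p^n) \<longrightarrow>
      (\<exists>z\<in>padic_Ints. F b + G b - (F a + G a) = of_nat CARD('p) ^ j * z)"
  proof (intro exI[of _ "max m n"] allI impI)
    fix b assume b: "[b = a] (mod_p^max m n)"
    obtain u v where "u \<in> padic_Ints" "F b - F a = of_nat CARD('p) ^ j * u"
      "v \<in> padic_Ints" "G b - G a = of_nat CARD('p) ^ j * v"
      using m n padic_cong_weaken[OF b] by (meson max.cobounded1 max.cobounded2)
    then show "\<exists>z\<in>padic_Ints. F b + G b - (F a + G a) = of_nat CARD('p) ^ j * z"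
      by (intro bexI[of _ "u + v"]) (auto simp: algebra_simps)
  qed
qed

text \<open>The error of each factor must absorb the denominator of the other factor at
  \<open>a\<close>; hence the precisions \<open>j + t\<close> and \<open>j + s\<close>.\<close>

lemma padic_continuous_mult:
  fixes a :: "'p::prime_card padic"
  assumes "padic_continuous F a" "padic_continuous G a"
  shows "padic_continuous (\<lambda>x. F x * G x) a"
  unfolding padic_continuous_def
proof
  fix j
  let ?p = "of_nat CARD('p) :: 'p padic"
  obtain s t where st: "?p ^ s * F a \<in> padic_Ints" "?p ^ t * G a \<in> padic_Ints"
    by (meson padic_denominator)
  obtain m n where
    m: "\<And>b. [b = a] (mod_p^m) \<Longrightarrow> \<exists>z\<in>padic_Ints. F b - F a = ?p ^ (j + t) * z" and
    n: "\<And>b. [b = a] (mod_p^n) \<Longrightarrow> \<exists>z\<in>padic_Ints. G b - G a = ?p ^ (j + s) * z"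
    using assms unfolding padic_continuous_def by metis
  show "\<exists>n. \<forall>b. [b = a] (mod_p^n) \<longrightarrow> (\<exists>z\<in>padic_Ints. F b * G b - F a * G a = ?p ^ j * z)"
  proof (intro exI[of _ "max m n"] allI impI)
    fix b assume b: "[b = a] (mod_p^max m n)"
    obtain u v where uv: "u \<in> padic_Ints" "F b - F a = ?p ^ (j + t) * u"
      "v \<in> padic_Ints" "G b - G a = ?p ^ (j + s) * v"
      using m n padic_cong_weaken[OF b] by (meson max.cobounded1 max.cobounded2)
    have "F b = F a + ?p ^ (j + t) * u" "G b = G a + ?p ^ (j + s) * v"
      using uv by (simp_all add: algebra_simps)
    then have "F b * G b - F a * G a
      = ?p ^ j * (u * (?p ^ t * G a) + (?p ^ s * F a) * v + ?p ^ (j + s + t) * u * v)"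
      by (simp add: algebra_simps power_add)
    then show "\<exists>z\<in>padic_Ints. F b * G b - F a * G a = ?p ^ j * z"
      by (rule bexI) (use st uv in auto)
  qed
qed

lemma padic_continuous_diff:
  assumes "padic_continuous F a" "padic_continuous G a"
  shows "padic_continuous (\<lambda>x. F x - G x) a"
  using padic_continuous_add[OF assms(1)
      padic_continuous_mult[OF padic_continuous_const[of "-1"] assms(2)]] by simp

lemma padic_continuous_uminus: "padic_continuous F a \<Longrightarrow> padic_continuous (\<lambda>x. - F x) a"
  using padic_continuous_mult[OF padic_continuous_const[of "-1"]] by simp

lemma padic_continuous_divide:
  "padic_continuous F a \<Longrightarrow> padic_continuous (\<lambda>x. F x / c) a"
  using padic_continuous_mult[OF _ padic_continuous_const[of "inverse c"]]
  by (simp add: divide_inverse)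

lemma padic_continuous_sum:
  "(\<And>i. i \<in> A \<Longrightarrow> padic_continuous (F i) a) \<Longrightarrow> padic_continuous (\<lambda>x. \<Sum>i\<in>A. F i x) a"
  by (induction A rule: infinite_finite_induct)
    (auto intro: padic_continuous_const padic_continuous_add)

lemma padic_continuous_prod:
  "(\<And>i. i \<in> A \<Longrightarrow> padic_continuous (F i) a) \<Longrightarrow> padic_continuous (\<lambda>x. \<Prod>i\<in>A. F i x) a"
  by (induction A rule: infinite_finite_induct)
    (auto intro: padic_continuous_const padic_continuous_mult)

lemma padic_continuous_power: "padic_continuous F a \<Longrightarrow> padic_continuous (\<lambda>x. F x ^ n) a"
  by (induction n) (auto intro: padic_continuous_const padic_continuous_mult)

lemma padic_continuous_gbinomial:
  "padic_continuous F a \<Longrightarrow> padic_continuous (\<lambda>x. F x gchoose k) a"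
  unfolding gbinomial_prod_rev
  by (intro padic_continuous_divide padic_continuous_prod padic_continuous_diff
      padic_continuous_const)

lemmas padic_continuous_intros =
  padic_continuous_const padic_continuous_id padic_continuous_add padic_continuous_mult
  padic_continuous_diff padic_continuous_uminus padic_continuous_divide padic_continuous_sum
  padic_continuous_power padic_continuous_gbinomial


section \<open>Bernoulli and Euler polynomials\<close>

text \<open>The power series identities are proved over the rationals; this transports their
  consequences to the p-adic numbers.\<close>

lemma bernoulli_poly_of_rat: "bernoulli_poly n (of_rat x :: 'a::field_char_0) = of_rat (bernoulli_poly n x)"
  by (simp add: bernoulli_poly_def of_rat_sum of_rat_mult of_rat_power)

lemma euler_poly_of_rat: "euler_poly n (of_rat x :: 'a::field_char_0) = of_rat (euler_poly n x)"
  by (simp add: euler_poly_def of_rat_sum of_rat_mult of_rat_power of_rat_divide of_rat_diff)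

text \<open>Binomial convolution is multiplication of exponential generating functions, and
  \<open>fps_exp x\<close> generates the powers of \<open>x\<close>.\<close>

lemma sum_binomial_fps:
  fixes f :: "'a::field_char_0 fps"
  shows "(\<Sum>k\<le>n. of_nat (n choose k) * (fact k * fps_nth f k) * x ^ (n - k))
    = fact n * fps_nth (f * fps_exp x) n"
proof -
  have "of_nat (n choose k) * (fact k * fps_nth f k) * x ^ (n - k)
      = fact n * (fps_nth f k * (x ^ (n - k) / fact (n - k)))" if "k \<le> n" for k
    using that by (simp add: binomial_fact field_simps)
  then show ?thesis
    by (simp add: fps_mult_nth sum_distrib_left atLeast0AtMost)
qed

definition bernoulli_fps :: "rat fps"
  where "bernoulli_fps = fps_X / (fps_exp 1 - 1)"

text \<open>Substituting t/2 absorbs the powers \<open>2 ^ k\<close> in the Euler polynomial; the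
  series is 1 / cosh (t/2).\<close>

definition euler_fps :: "rat fps"
  where "euler_fps = (2 / (fps_exp 1 + fps_exp (- 1))) oo (fps_const (1 / 2) * fps_X)"

lemma bernoulli_poly_conv_fps:
  "bernoulli_poly n x = fact n * fps_nth (bernoulli_fps * fps_exp x) n"
  unfolding sum_binomial_fps[symmetric]
  by (simp add: bernoulli_poly_def bernoulli_def bernoulli_fps_def)

lemma euler_poly_conv_fps:
  "euler_poly n x = fact n * fps_nth (euler_fps * fps_exp (x - 1 / 2)) n" for x :: rat
proof -
  have "euler_num k / 2 ^ k = fact k * fps_nth euler_fps k" for k
    unfolding euler_num_def euler_fps_def fps_compose_linear by (simp add: power_one_over)
  then show ?thesis
    unfolding sum_binomial_fps[symmetric] by (simp add: euler_poly_def)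
qed

lemma bernoulli_fps_mult: "bernoulli_fps * (fps_exp 1 - 1) = fps_X"
proof -
  \<comment> \<open>Numerator and denominator both have order 1, so the quotient of power series is
    exact.\<close>
  have "subdegree (fps_exp 1 - 1 :: rat fps) = 1"
    by (rule subdegreeI) auto
  then have "(fps_exp 1 - 1 :: rat fps) dvd fps_X"
    by (subst fps_dvd_iff) auto
  then show ?thesis
    by (simp add: bernoulli_fps_def)
qed

lemma euler_fps_mult: "euler_fps * (fps_exp (1 / 2) + fps_exp (- (1 / 2))) = 2"
proof -
  let ?h = "fps_const (1 / 2) * fps_X :: rat fps"
  define G where "G = (2 / (fps_exp 1 + fps_exp (- 1)) :: rat fps)"
  \<comment> \<open>The constant term 2 is a unit, so this division is exact as well.\<close>
  have "(fps_exp 1 + fps_exp (- 1) :: rat fps) dvd 2"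
    by (rule fps_unit_dvd) simp
  then have "G * (fps_exp 1 + fps_exp (- 1)) = 2"
    by (simp add: G_def)
  then have "(G * (fps_exp 1 + fps_exp (- 1))) oo ?h = 2 oo ?h"
    by (simp only:)
  moreover have "(G * (fps_exp 1 + fps_exp (- 1))) oo ?h = (G oo ?h) * ((fps_exp 1 + fps_exp (- 1)) oo ?h)"
    by (rule fps_compose_mult_distrib) simp
  moreover have "(fps_exp 1 + fps_exp (- 1)) oo ?h = fps_exp (1 / 2) + fps_exp (- (1 / 2))"
    unfolding fps_compose_add_distrib fps_exp_compose_linear by simp
  ultimately show ?thesis
    by (simp add: euler_fps_def G_def)
qed

text \<open>Shifting \<open>x\<close> by 1 multiplies the generating function by
  \<open>fps_exp 1\<close>, and \<open>fps_exp 1 - 1\<close> is the denominator of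
  \<open>bernoulli_fps\<close>.\<close>

lemma bernoulli_poly_add_1:
  "bernoulli_poly n (x + 1) - bernoulli_poly n x = of_nat n * x ^ (n - 1)" for x :: rat
proof -
  have "bernoulli_fps * fps_exp (x + 1) - bernoulli_fps * fps_exp x
      = bernoulli_fps * (fps_exp 1 - 1) * fps_exp x"
    by (simp add: fps_exp_add_mult algebra_simps)
  also have "\<dots> = fps_X * fps_exp x"
    by (simp only: bernoulli_fps_mult)
  finally have "bernoulli_poly n (x + 1) - bernoulli_poly n x = fact n * fps_nth (fps_X * fps_exp x) n"
    by (metis bernoulli_poly_conv_fps fps_sub_nth right_diff_distrib)
  also have "\<dots> = of_nat n * x ^ (n - 1)"
    by (cases n) auto
  finally show ?thesis .
qed

text \<open>Relative to the centre 1/2, the arguments become x + 1/2 and x - 1/2; adding the two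
  exponentials produces the denominator of \<open>euler_fps\<close>.\<close>

lemma euler_poly_add_1:
  "euler_poly n (x + 1) + euler_poly n x = 2 * x ^ n" for x :: rat
proof -
  have e: "fps_exp (x + 1 - 1 / 2) = fps_exp x * fps_exp (1 / 2)"
    "fps_exp (x - 1 / 2) = fps_exp x * fps_exp (- (1 / 2))"
    by (simp_all flip: fps_exp_add_mult)
  have "euler_fps * fps_exp (x + 1 - 1 / 2) + euler_fps * fps_exp (x - 1 / 2)
      = (euler_fps * (fps_exp (1 / 2) + fps_exp (- (1 / 2)))) * fps_exp x"
    unfolding e by (simp add: algebra_simps)
  also have "\<dots> = 2 * fps_exp x"
    by (simp only: euler_fps_mult)
  finally have "euler_poly n (x + 1) + euler_poly n x = fact n * fps_nth (2 * fps_exp x) n"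
    by (metis euler_poly_conv_fps fps_add_nth distrib_left)
  also have "\<dots> = 2 * x ^ n"
    by (simp add: numeral_fps_const)
  finally show ?thesis .
qed

text \<open>The series satisfies \<open>B(-t) = B(t) e\<^sup>t\<close>.\<close>
lemma bernoulli_poly_1_odd:
  assumes "odd n" "n \<noteq> 1"
  shows "bernoulli_poly n (1 :: rat) = 0"
proof -
  define B' where "B' = bernoulli_fps oo - fps_X"
  have "(bernoulli_fps * (fps_exp 1 - 1)) oo - fps_X = fps_X oo - fps_X"
    by (simp only: bernoulli_fps_mult)
  then have B': "B' * (fps_exp (- 1) - 1) = - fps_X"
    by (simp add: B'_def fps_compose_mult_distrib fps_compose_sub_distrib)
  have ee: "fps_exp (- 1) * fps_exp 1 = (1 :: rat fps)"
    by (simp flip: fps_exp_add_mult)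
  have "B' * (fps_exp 1 - 1) = - (B' * (fps_exp (- 1) - 1)) * fps_exp 1"
    using ee by (simp add: algebra_simps)
  also have "\<dots> = bernoulli_fps * fps_exp 1 * (fps_exp 1 - 1)"
    unfolding B' using bernoulli_fps_mult by (simp add: algebra_simps)
  finally have "B' * (fps_exp 1 - 1) = bernoulli_fps * fps_exp 1 * (fps_exp 1 - 1)" .
  moreover have "fps_exp 1 - 1 \<noteq> (0 :: rat fps)"
    using bernoulli_fps_mult by auto
  ultimately have 1: "B' = bernoulli_fps * fps_exp 1"
    by simp
  have "fps_nth B' n = - fps_nth bernoulli_fps n"
    using assms(1) by (simp add: B'_def fps_compose_uminus')
  moreover have "bernoulli_poly n 0 = fact n * fps_nth bernoulli_fps n"
    by (simp add: bernoulli_poly_conv_fps)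
  ultimately have "bernoulli_poly n (1 :: rat) = - bernoulli_poly n 0"
    unfolding bernoulli_poly_conv_fps 1[symmetric] by simp
  moreover have "bernoulli_poly n (1 :: rat) = bernoulli_poly n 0"
    using bernoulli_poly_add_1[of n 0] assms by (auto simp: power_0_left elim: oddE)
  ultimately show ?thesis by simp
qed

text \<open>As \<open>euler_fps\<close> is even, the values at 0 and 1 agree for even
  \<open>n\<close>; by the difference equation at 0 their sum vanishes when
  \<open>n > 0\<close>.\<close>

lemma euler_poly_1_even:
  assumes "even n" "n > 0"
  shows "euler_poly n (1 :: rat) = 0"
proof -
  define E' where "E' = euler_fps oo - fps_X"
  have "(euler_fps * (fps_exp (1 / 2) + fps_exp (- (1 / 2)))) oo - fps_X = 2 oo - fps_X"
    by (simp only: euler_fps_mult)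
  then have "E' * (fps_exp (1 / 2) + fps_exp (- (1 / 2))) = 2"
    by (simp add: E'_def fps_compose_mult_distrib fps_compose_add_distrib add.commute)
  moreover have "fps_exp (1 / 2) + fps_exp (- (1 / 2)) \<noteq> (0 :: rat fps)"
    using euler_fps_mult by auto
  ultimately have "E' = euler_fps"
    using euler_fps_mult by (metis mult_right_cancel)
  then have "euler_fps * fps_exp (1 / 2) = (euler_fps * fps_exp (- (1 / 2))) oo - fps_X"
    by (simp add: E'_def fps_compose_mult_distrib)
  then have "fps_nth (euler_fps * fps_exp (1 / 2)) n = fps_nth (euler_fps * fps_exp (- (1 / 2))) n"
    using assms(1) by (simp add: fps_compose_uminus')
  then have "euler_poly n (1 :: rat) = euler_poly n 0"
    by (simp add: euler_poly_conv_fps)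
  moreover have "euler_poly n 1 + euler_poly n (0 :: rat) = 0"
    using euler_poly_add_1[of n 0] assms by (simp add: power_0_left)
  ultimately show ?thesis by simp
qed

section \<open>Difference equations for the binomial sums\<close>

definition gbinomial_pair :: "nat \<Rightarrow> 'a::field_char_0 \<Rightarrow> 'a"
  where "gbinomial_pair k x = ((- x) gchoose k) * ((x - 1) gchoose k)"

text \<open>A partial product of \<open>sin (\<pi> x) / (\<pi> x)\<close>.\<close>
definition sine_prod :: "nat \<Rightarrow> 'a::field_char_0 \<Rightarrow> 'a"
  where "sine_prod n x = (\<Prod>i=1..n. 1 - x ^ 2 / of_nat i ^ 2)"

text \<open>Summation by parts applied to twice the sum of (g_k - g_(k-1)) H_k over 0 < k <= n,
  where g is \<open>sine_prod\<close>; the common right-hand side of both difference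
  equations.\<close>

definition harm2_defect :: "nat \<Rightarrow> 'a::field_char_0 \<Rightarrow> 'a"
  where "harm2_defect n x =
    2 * (sine_prod n x * harm2 n - (\<Sum>j<n. sine_prod j x / of_nat (Suc j) ^ 2))"

definition harm2_sum :: "nat \<Rightarrow> 'a::field_char_0 \<Rightarrow> 'a"
  where "harm2_sum n x = (\<Sum>k=0..n. gbinomial_pair k x * harm2 k)"

definition harm2_odd_sum :: "nat \<Rightarrow> 'a::field_char_0 \<Rightarrow> 'a"
  where "harm2_odd_sum n x = (2 * x - 1) * (\<Sum>k=0..n. gbinomial_pair k x * (harm2 k / (2 * of_nat k + 1)))"

lemma harm2_0 [simp]: "harm2 0 = 0"
  by (simp add: harm2_def)

lemma harm2_Suc: "harm2 (Suc n) = harm2 n + 1 / of_nat (Suc n) ^ 2"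
proof -
  have "{0<..Suc n} = insert (Suc n) {0<..n}" by auto
  then show ?thesis by (simp add: harm2_def)
qed

lemma harm2_altdef: "harm2 n = (\<Sum>j<n. 1 / of_nat (Suc j) ^ 2)"
  by (induction n) (auto simp: harm2_Suc)

lemma sine_prod_0 [simp]: "sine_prod 0 x = 1"
  by (simp add: sine_prod_def)

lemma sine_prod_Suc: "sine_prod (Suc n) x = sine_prod n x * (1 - x ^ 2 / of_nat (Suc n) ^ 2)"
  by (simp add: sine_prod_def)

lemma sine_prod_minus: "sine_prod n (- x) = sine_prod n x"
  by (simp add: sine_prod_def)

lemma gbinomial_pair_0 [simp]: "gbinomial_pair 0 x = 1"
  by (simp add: gbinomial_pair_def)

text \<open>The substitution merely swaps the two binomial factors, so formulas at
  \<open>x + 1\<close> follow from those at \<open>x\<close> by the sign change under which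
  \<open>sine_prod\<close> is invariant.\<close>

lemma gbinomial_pair_add_1: "gbinomial_pair k (x + 1) = gbinomial_pair k (- x)"
proof -
  have "- (x + 1) = - x - 1" "x + 1 - 1 = x" by simp_all
  then show ?thesis
    unfolding gbinomial_pair_def by (simp only: minus_minus mult.commute)
qed

lemma gbinomial_pair_Suc_rec:
  "gbinomial_pair (Suc k) x
    = gbinomial_pair k x * (- (x + of_nat k) * (x - of_nat (Suc k))) / of_nat (Suc k) ^ 2"
proof -
  have "y gchoose Suc k = (y gchoose k) * (y - of_nat k) / of_nat (Suc k)" for y :: 'a
    by (simp add: gbinomial_prod_rev)
  then have "gbinomial_pair (Suc k) x
      = gbinomial_pair k x * ((- x - of_nat k) * (x - 1 - of_nat k)) / of_nat (Suc k) ^ 2"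
    unfolding gbinomial_pair_def by (simp add: power2_eq_square mult_ac)
  also have "(- x - of_nat k) * (x - 1 - of_nat k) = - (x + of_nat k) * (x - of_nat (Suc k))"
    by (simp add: algebra_simps)
  finally show ?thesis .
qed

text \<open>The linear factors x + i and x - i pair up into 1 - x^2 / i^2 for i <= k; the factors x
  and x - (k + 1) remain unpaired.\<close>

lemma gbinomial_pair_Suc:
  "gbinomial_pair (Suc k) x = - x * (x - of_nat (Suc k)) / of_nat (Suc k) ^ 2 * sine_prod k x"
proof (induction k)
  case 0
  then show ?case by (simp add: gbinomial_pair_def)
next
  case (Suc k)
  define K where "K = (of_nat (Suc k) :: 'a)"
  have K: "K \<noteq> 0" unfolding K_def by (rule of_nat_neq_0)
  have IH: "gbinomial_pair (Suc k) x = - x * (x - K) / K ^ 2 * sine_prod k x"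
    using Suc by (simp only: K_def)
  have g: "sine_prod (Suc k) x = sine_prod k x * (1 - x ^ 2 / K ^ 2)"
    by (simp only: sine_prod_Suc K_def)
  \<comment> \<open>The unpaired factor x - K of the previous stage meets the new factor x + K and
    completes \<open>sine_prod (Suc k) x\<close>.\<close>
  have 1: "(- x * (x - K) / K ^ 2) * (- (x + K)) = - x * (1 - x ^ 2 / K ^ 2)"
    using K by (simp add: field_simps power2_eq_square)
  have "gbinomial_pair (Suc (Suc k)) x
      = ((- x * (x - K) / K ^ 2) * (- (x + K))) * sine_prod k x * (x - of_nat (Suc (Suc k))) / of_nat (Suc (Suc k)) ^ 2"
    unfolding gbinomial_pair_Suc_rec[of "Suc k"] IH K_def[symmetric] by (simp only: mult_ac)
  then show ?case
    unfolding 1 g by (simp only: mult_ac times_divide_eq_left times_divide_eq_right)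
qed

lemma gbinomial_pair_Suc_add_1:
  "gbinomial_pair (Suc k) (x + 1) = - x * (x + of_nat (Suc k)) / of_nat (Suc k) ^ 2 * sine_prod k x"
  unfolding gbinomial_pair_add_1 gbinomial_pair_Suc sine_prod_minus
  by (simp add: algebra_simps)

lemma harm2_defect_Suc:
  "harm2_defect (Suc n) x
    = harm2_defect n x + 2 * (sine_prod (Suc n) x - sine_prod n x) * harm2 (Suc n)"
  by (simp add: harm2_defect_def harm2_Suc algebra_simps)

lemma harm2_sum_add_1: "harm2_sum n (x + 1) + harm2_sum n x = harm2_defect n x"
proof (induction n)
  case 0
  then show ?case by (simp add: harm2_sum_def harm2_defect_def)
next
  case (Suc n)
  \<comment> \<open>With N = n + 1, the numerators -x (x + N) and -x (x - N) add up to -2 x^2, which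
    is also the numerator in the increment of 2 g.\<close>
  have "gbinomial_pair (Suc n) (x + 1) + gbinomial_pair (Suc n) x
      = 2 * (sine_prod (Suc n) x - sine_prod n x)"
    unfolding gbinomial_pair_Suc_add_1
    unfolding gbinomial_pair_Suc sine_prod_Suc
    by (simp add: divide_simps) (simp add: algebra_simps power2_eq_square)
  then have "harm2_defect (Suc n) x = harm2_defect n x
      + (gbinomial_pair (Suc n) (x + 1) + gbinomial_pair (Suc n) x) * harm2 (Suc n)"
    by (simp only: harm2_defect_Suc)
  then show ?case
    using Suc by (simp add: harm2_sum_def algebra_simps)
qed

lemma harm2_odd_sum_add_1: "harm2_odd_sum n (x + 1) - harm2_odd_sum n x = harm2_defect n x"
proof (induction n)
  case 0
  then show ?case by (simp add: harm2_odd_sum_def harm2_defect_def)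
next
  case (Suc n)
  define N where "N = (of_nat (Suc n) :: 'a)"
  have N: "N \<noteq> 0" unfolding N_def by (rule of_nat_neq_0)
  have "2 * N + 1 = of_nat (2 * Suc n + 1)" by (simp add: N_def)
  then have N': "2 * N + 1 \<noteq> 0" by (simp only: of_nat_neq_0 Suc_eq_plus1[symmetric] not_False_eq_True)
  define A where "A y = (2 * y - 1) * gbinomial_pair (Suc n) y" for y :: 'a
  \<comment> \<open>Here (2x + 1)(x + N) - (2x - 1)(x - N) = 2x (2N + 1), so the denominator 2N + 1
    of the summand cancels.\<close>
  have "A (x + 1) - A x = (2 * N + 1) * (2 * (sine_prod (Suc n) x - sine_prod n x))"
    unfolding A_def gbinomial_pair_Suc_add_1
    unfolding gbinomial_pair_Suc sine_prod_Suc N_def[symmetric]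
    using N by (simp add: field_simps power2_eq_square)
  then have "2 * (sine_prod (Suc n) x - sine_prod n x) = (A (x + 1) - A x) / (2 * N + 1)"
    using N' by (simp add: field_simps)
  then have "harm2_defect (Suc n) x
      = harm2_defect n x + (A (x + 1) - A x) / (2 * N + 1) * harm2 (Suc n)"
    by (simp only: harm2_defect_Suc)
  moreover have "harm2_odd_sum (Suc n) y = harm2_odd_sum n y + A y / (2 * N + 1) * harm2 (Suc n)" for y
    by (simp add: harm2_odd_sum_def A_def N_def distrib_left)
  ultimately show ?case
    using Suc by (simp add: diff_divide_distrib left_diff_distrib)
qed

lemma gbinomial_pair_1: "k > 0 \<Longrightarrow> gbinomial_pair k 1 = 0"
  by (cases k) (simp_all add: gbinomial_pair_def)

text \<open>Starting value for the induction over natural arguments: at 1 only the summand k = 0 has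
  a nonzero binomial factor, and there the harmonic number vanishes.\<close>

lemma harm2_sum_1 [simp]: "harm2_sum n 1 = 0"
  unfolding harm2_sum_def by (rule sum.neutral) (metis gbinomial_pair_1 harm2_0 gr0I mult_eq_0_iff)

lemma harm2_odd_sum_1 [simp]: "harm2_odd_sum n 1 = 0"
proof -
  have "(\<Sum>k=0..n. gbinomial_pair k 1 * (harm2 k / (2 * of_nat k + 1))) = (0 :: 'a)"
  proof (rule sum.neutral, rule ballI)
    fix k
    show "gbinomial_pair k 1 * (harm2 k / (2 * of_nat k + 1)) = (0 :: 'a)"
      by (cases "k = 0") (auto simp: gbinomial_pair_1)
  qed
  then show ?thesis by (simp add: harm2_odd_sum_def)
qed

text \<open>Each summand times x^2 is the decrement of \<open>sine_prod\<close> from j to j + 1.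
  This evaluates the sum in \<open>harm2_defect\<close> at arguments prime to p.\<close>

lemma sine_prod_telescope:
  "x ^ 2 * (\<Sum>j<n. sine_prod j x / of_nat (Suc j) ^ 2) = 1 - sine_prod n x"
  by (induction n) (auto simp: sine_prod_Suc algebra_simps)


section \<open>Sums of inverse squares prime to p\<close>

text \<open>Extending by 0 to multiples of p lets sums run over all \<open>k < m\<close> and makes
  the summand periodic modulo powers of p.\<close>

definition unit_inv_sq :: "nat \<Rightarrow> 'p::prime_card padic"
  where "unit_inv_sq k = (if CARD('p) dvd k then 0 else 1 / of_nat k ^ 2)"

lemma of_nat_CARD_neq_0 [simp]: "(of_nat CARD('p) :: 'p::prime_card padic) \<noteq> 0"
  using prime_gt_0_nat[OF prime_card[where 'a='p]] by simp

lemma padic_Ints_inverse_square: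
  "\<not> CARD('p) dvd k \<Longrightarrow> 1 / of_nat k ^ 2 \<in> (padic_Ints :: 'p::prime_card padic set)"
  using padic_Ints_power[OF padic_Ints_inverse_of_nat, of k 2] by (simp add: power_one_over)

lemma unit_inv_sq_in_padic_Ints [simp, intro]: "unit_inv_sq k \<in> (padic_Ints :: 'p::prime_card padic set)"
  by (simp add: unit_inv_sq_def padic_Ints_inverse_square)

lemma not_CARD_dvd_Suc: "Suc j < CARD('p) \<Longrightarrow> \<not> CARD('p) dvd Suc j"
  by (auto dest: dvd_imp_le)

lemma harm2_in_padic_Ints: "n < CARD('p) \<Longrightarrow> harm2 n \<in> (padic_Ints :: 'p::prime_card padic set)"
  unfolding harm2_altdef
  by (intro padic_Ints_sum padic_Ints_inverse_square not_CARD_dvd_Suc) simp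

lemma sine_prod_in_padic_Ints:
  fixes x :: "'p::prime_card padic"
  assumes "n < CARD('p)" "x \<in> padic_Ints"
  shows "sine_prod n x \<in> padic_Ints"
proof -
  have "1 - x ^ 2 * (1 / of_nat i ^ 2) \<in> padic_Ints" if "i \<in> {1..n}" for i
    using that assms
    by (intro padic_Ints_closed(7,8) padic_Ints_closed(2) padic_Ints_power padic_Ints_inverse_square)
      (auto dest: dvd_imp_le)
  then show ?thesis
    unfolding sine_prod_def by (intro padic_Ints_prod) simp
qed

lemma sine_quotient_in_padic_Ints:
  fixes x :: "'p::prime_card padic"
  assumes "Suc j < CARD('p)" "x \<in> padic_Ints"
  shows "sine_prod j x / of_nat (Suc j) ^ 2 \<in> padic_Ints"
proof -
  have "sine_prod j x * (1 / of_nat (Suc j) ^ 2) \<in> padic_Ints"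
    using assms by (intro padic_Ints_closed(8) sine_prod_in_padic_Ints
        padic_Ints_inverse_square not_CARD_dvd_Suc) auto
  then show ?thesis by simp
qed

text \<open>Some i between 1 and p - 1 is congruent to -c; its factor supplies p while the others
  are integral. An integer \<open>c\<close> admits both signs.\<close>

lemma linear_prod_divisible:
  assumes "\<not> int CARD('p) dvd c"
  obtains z where "z \<in> padic_Ints"
    "(\<Prod>i=1..CARD('p)-1. 1 + of_int c / of_nat i :: 'p::prime_card padic) = of_nat CARD('p) * z"
proof -
  let ?P = "CARD('p)"
  define r where "r = (- c) mod int ?P"
  define i where "i = nat r"
  have "r \<noteq> 0" using assms by (simp add: r_def mod_eq_0_iff_dvd)
  moreover have "0 \<le> r" "r < int ?P"
    using prime_gt_0_nat[OF prime_card[where 'a='p]] by (simp_all add: r_def)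
  ultimately have i: "i \<in> {1..?P-1}" and int_i: "int i = (- c) mod int ?P"
    unfolding i_def r_def[symmetric] atLeastAtMost_iff by linarith+
  have "int ?P dvd int i + c"
    unfolding int_i by (simp add: dvd_eq_mod_eq_0 mod_simps)
  then obtain q where "int i + c = int ?P * q" ..
  then have "of_int (int i + c) = (of_int (int ?P * q) :: 'p padic)"
    by (simp only:)
  then have q: "of_nat i + of_int c = (of_nat ?P * of_int q :: 'p padic)"
    by simp
  have of_int: "of_int b \<in> (padic_Ints :: 'p padic set)" for b :: int
    by (cases b rule: int_cases2) auto
  have inv: "1 / of_nat k \<in> (padic_Ints :: 'p padic set)" if "k \<in> {1..?P-1}" for k
    using that by (intro padic_Ints_inverse_of_nat) (auto dest: dvd_imp_le)
  have "1 + of_int c / of_nat i = (of_nat i + of_int c) * (1 / of_nat i :: 'p padic)"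
    using i by (simp add: field_simps)
  then have fi: "1 + of_int c / of_nat i = of_nat ?P * (of_int q * (1 / of_nat i) :: 'p padic)"
    unfolding q by (simp only: mult.assoc)
  have "1 + of_int c * (1 / of_nat k) \<in> (padic_Ints :: 'p padic set)" if "k \<in> {1..?P-1}" for k
    using of_int inv[OF that] by (intro padic_Ints_closed(2,6,8))
  then have "(\<Prod>k\<in>{1..?P-1}-{i}. 1 + of_int c / of_nat k :: 'p padic) \<in> padic_Ints"
    by (intro padic_Ints_prod) simp
  moreover have "(\<Prod>i=1..?P-1. 1 + of_int c / of_nat i :: 'p padic)
    = of_nat ?P * ((of_int q * (1 / of_nat i)) * (\<Prod>k\<in>{1..?P-1}-{i}. 1 + of_int c / of_nat k))"
    by (subst prod.remove[OF _ i], simp, unfold fi, simp only: mult.assoc)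
  ultimately show ?thesis
    using that of_int inv[OF i] by (metis padic_Ints_closed(8))
qed

text \<open>Factoring 1 - m^2 / i^2 into (1 + m/i)(1 - m/i) gives two products, each contributing
  one factor p.\<close>

lemma sine_prod_cong_0:
  assumes "\<not> CARD('p) dvd m"
  shows "[sine_prod (CARD('p) - 1) (of_nat m) = (0 :: 'p::prime_card padic)] (mod_p^2)"
proof -
  obtain y z :: "'p padic" where yz: "y \<in> padic_Ints" "z \<in> padic_Ints"
    "(\<Prod>i=1..CARD('p)-1. 1 + of_int (int m) / of_nat i) = of_nat CARD('p) * y"
    "(\<Prod>i=1..CARD('p)-1. 1 + of_int (- int m) / of_nat i) = of_nat CARD('p) * z"
    using linear_prod_divisible[where 'p='p, of "int m"] linear_prod_divisible[where 'p='p, of "- int m"] assms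
    by (metis dvd_minus_iff int_dvd_int_iff)
  have "sine_prod (CARD('p) - 1) (of_nat m :: 'p padic)
    = (\<Prod>i=1..CARD('p)-1. 1 + of_int (int m) / of_nat i) * (\<Prod>i=1..CARD('p)-1. 1 + of_int (- int m) / of_nat i)"
    unfolding sine_prod_def prod.distrib[symmetric]
    by (rule prod.cong) (auto simp: field_simps power2_eq_square)
  also have "\<dots> = of_nat CARD('p) ^ 2 * (y * z)"
    unfolding yz by (simp add: power2_eq_square)
  finally show ?thesis
    using yz by (intro padic_congI[of _ "y * z"]) auto
qed

lemma sine_prod_cong_1:
  assumes "CARD('p) dvd m" "n < CARD('p)"
  shows "[sine_prod n (of_nat m) = (1 :: 'p::prime_card padic)] (mod_p^2)"
  using assms(2)
proof (induction n)
  case 0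
  then show ?case by simp
next
  case (Suc n)
  obtain q where q: "m = CARD('p) * q" using assms(1) ..
  have "[1 - of_nat m ^ 2 / of_nat (Suc n) ^ 2 = (1 :: 'p padic)] (mod_p^2)"
  proof (rule padic_congI)
    show "- (of_nat q ^ 2 * (1 / of_nat (Suc n) ^ 2)) \<in> (padic_Ints :: 'p padic set)"
      using Suc.prems
      by (intro padic_Ints_closed(3,5,8) padic_Ints_power padic_Ints_inverse_square not_CARD_dvd_Suc)
  qed (auto simp: q power_mult_distrib)
  from padic_cong_mult[OF Suc.IH this] Suc.prems show ?case
    by (simp add: sine_prod_Suc)
qed

text \<open>At multiples of p every \<open>sine_prod\<close> is 1 modulo p^2, so both terms become
  the same harmonic number and cancel. Otherwise the last \<open>sine_prod\<close> is 0 and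
  telescoping leaves 1 / m^2.\<close>

lemma harm2_defect_cong:
  "[harm2_defect (CARD('p) - 1) (of_nat m) = - 2 * (unit_inv_sq m :: 'p::prime_card padic)] (mod_p^2)"
proof -
  let ?n = "CARD('p) - 1"
  let ?g = "\<lambda>j. sine_prod j (of_nat m) :: 'p padic"
  let ?s = "\<Sum>j<?n. ?g j / of_nat (Suc j) ^ 2"
  have n: "?n < CARD('p)"
    using prime_gt_0_nat[OF prime_card[where 'a='p]] by simp
  have H: "harm2 ?n \<in> (padic_Ints :: 'p padic set)"
    using n by (rule harm2_in_padic_Ints)
  have s: "?s \<in> padic_Ints"
    by (intro padic_Ints_sum sine_quotient_in_padic_Ints) auto
  show ?thesis
  proof (cases "CARD('p) dvd m")
    case True
    have "[?g j * (1 / of_nat (Suc j) ^ 2) = 1 * (1 / of_nat (Suc j) ^ 2)] (mod_p^2)" if "j < ?n" for j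
      using that True by (intro padic_cong_mult sine_prod_cong_1 padic_cong_refl
          padic_Ints_inverse_square not_CARD_dvd_Suc) auto
    then have "[?s = (\<Sum>j<?n. 1 / of_nat (Suc j) ^ 2)] (mod_p^2)"
      by (intro padic_cong_sum) simp
    then have "[?s = harm2 ?n] (mod_p^2)"
      by (simp only: harm2_altdef)
    then have "[2 * (?g ?n * harm2 ?n - ?s) = 2 * (1 * harm2 ?n - harm2 ?n)] (mod_p^2)"
      using H True n by (intro padic_cong_mult padic_cong_diff sine_prod_cong_1 padic_cong_refl) auto
    then show ?thesis
      using True by (simp add: harm2_defect_def unit_inv_sq_def)
  next
    case False
    then have m: "(of_nat m :: 'p padic) \<noteq> 0" by (auto intro: gr0I)
    have u: "1 / of_nat m ^ 2 \<in> (padic_Ints :: 'p padic set)"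
      using False by (rule padic_Ints_inverse_square)
    have g: "[?g ?n = 0] (mod_p^2)"
      using False by (rule sine_prod_cong_0)
    have "?s = (1 / of_nat m ^ 2) * (of_nat m ^ 2 * ?s)"
      using m by simp
    also have "\<dots> = (1 / of_nat m ^ 2) * (1 - ?g ?n)"
      by (simp only: sine_prod_telescope)
    finally have s_eq: "?s = (1 / of_nat m ^ 2) * (1 - ?g ?n)" .
    have "[(1 / of_nat m ^ 2) * (1 - ?g ?n) = (1 / of_nat m ^ 2) * (1 - 0)] (mod_p^2)"
      using u g by (intro padic_cong_mult padic_cong_diff padic_cong_refl) auto
    then have "[?s = (1 / of_nat m ^ 2) * (1 - 0)] (mod_p^2)"
      by (simp only: s_eq)
    then have "[2 * (?g ?n * harm2 ?n - ?s) = 2 * (0 * harm2 ?n - (1 / of_nat m ^ 2) * (1 - 0))] (mod_p^2)"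
      using H g by (intro padic_cong_mult padic_cong_diff padic_cong_refl) auto
    then show ?thesis
      using False by (simp add: harm2_defect_def unit_inv_sq_def)
  qed
qed

text \<open>The exponent \<open>m + k\<close> has the parity of m - k; passing from m to m + 1
  negates the old sum and subtracts the new term, as in the Euler recurrence.\<close>

definition alt_sum :: "nat \<Rightarrow> 'p::prime_card padic"
  where "alt_sum m = (\<Sum>k<m. (- 1) ^ (m + k) * unit_inv_sq k)"

definition plain_sum :: "nat \<Rightarrow> 'p::prime_card padic"
  where "plain_sum m = (\<Sum>k<m. unit_inv_sq k)"

lemma alt_sum_conv:
  "(\<Sum>k | 0 < k \<and> k < m \<and> \<not> CARD('p) dvd k. (- 1) ^ (m - k) / of_nat k ^ 2)
    = (alt_sum m :: 'p::prime_card padic)"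
  unfolding alt_sum_def
  by (rule sum.mono_neutral_cong_left)
    (auto simp: unit_inv_sq_def minus_one_power_iff)

lemma plain_sum_conv:
  "(\<Sum>k | 0 < k \<and> k < m \<and> \<not> CARD('p) dvd k. 1 / of_nat k ^ 2)
    = (plain_sum m :: 'p::prime_card padic)"
  unfolding plain_sum_def
  by (rule sum.mono_neutral_cong_left) (auto simp: unit_inv_sq_def)

lemma alt_sum_Suc: "alt_sum (Suc m) = - alt_sum m - unit_inv_sq m"
  by (simp add: alt_sum_def sum_negf)

lemma plain_sum_Suc: "plain_sum (Suc m) = plain_sum m + unit_inv_sq m"
  by (simp add: plain_sum_def)

lemma alt_sum_in_padic_Ints [simp, intro]: "alt_sum m \<in> padic_Ints"
  by (induction m) (auto simp: alt_sum_Suc alt_sum_def[of 0])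

lemma plain_sum_in_padic_Ints [simp, intro]: "plain_sum m \<in> padic_Ints"
  by (induction m) (auto simp: plain_sum_Suc plain_sum_def[of 0])

lemma unit_inv_sq_0 [simp]: "unit_inv_sq 0 = 0"
  by (simp add: unit_inv_sq_def)

lemma alt_sum_1 [simp]: "alt_sum (Suc 0) = 0" and plain_sum_1 [simp]: "plain_sum (Suc 0) = 0"
  by (simp_all add: alt_sum_def plain_sum_def)

section \<open>Periodicity of the sums modulo powers of p\<close>

lemma unit_inv_sq_cong:
  assumes "[a = b] (mod CARD('p) ^ j)" "j > 0"
  shows "[unit_inv_sq a = (unit_inv_sq b :: 'p::prime_card padic)] (mod_p^j)"
proof -
  have "[a = b] (mod CARD('p))"
    using assms(1) by (rule cong_dvd_modulus_nat) (use assms(2) in simp)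
  then have dvd: "CARD('p) dvd a \<longleftrightarrow> CARD('p) dvd b"
    by (rule cong_dvd_iff)
  show ?thesis
  proof (cases "CARD('p) dvd b")
    case True
    then show ?thesis using dvd by (simp add: unit_inv_sq_def)
  next
    case False
    then have nz: "(of_nat a :: 'p padic) \<noteq> 0" "(of_nat b :: 'p padic) \<noteq> 0"
      using dvd by (auto intro!: gr0I)
    have ab: "1 / of_nat a ^ 2 \<in> (padic_Ints :: 'p padic set)" "1 / of_nat b ^ 2 \<in> (padic_Ints :: 'p padic set)"
      using False dvd by (auto intro!: padic_Ints_inverse_square)
    have "[of_nat b ^ 2 = (of_nat a :: 'p padic) ^ 2] (mod_p^j)"
      using cong_sym[OF assms(1)] by (intro padic_cong_power padic_cong_of_nat)
    \<comment> \<open>Multiplying by the integral element 1 / (a^2 b^2) turns a congruence of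
      squares into one of inverse squares.\<close>
    then have "[(1 / of_nat a ^ 2 * (1 / of_nat b ^ 2)) * of_nat b ^ 2
        = (1 / of_nat a ^ 2 * (1 / of_nat b ^ 2)) * (of_nat a :: 'p padic) ^ 2] (mod_p^j)"
      using ab by (intro padic_cong_mult padic_cong_refl) auto
    then show ?thesis
      using nz dvd False by (simp add: unit_inv_sq_def)
  qed
qed

text \<open>Multiplication by 2 permutes the residues modulo \<open>p\<^sup>j\<close> and divides each summand by 4,
  so the sum is annihilated by 3.\<close>
lemma plain_sum_period_0:
  assumes "CARD('p) > 3" "j > 0"
  shows "[plain_sum (CARD('p) ^ j) = (0 :: 'p::prime_card padic)] (mod_p^j)"
proof -
  let ?Q = "CARD('p) ^ j"
  let ?u = "unit_inv_sq :: nat \<Rightarrow> 'p padic"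
  let ?s = "plain_sum ?Q :: 'p padic"
  have p: "prime CARD('p)" by (rule prime_card)
  have Q: "?Q > 0" using p by (simp add: prime_gt_0_nat)
  have p2: "\<not> CARD('p) dvd 2" and p3: "\<not> CARD('p) dvd 3"
    using assms by (auto dest: dvd_imp_le)
  have cop: "coprime 2 ?Q"
    using prime_imp_coprime[OF p p2] by (simp add: coprime_commute)
  have u2: "?u (2 * k) = 1 / 4 * ?u k" for k
    using p2 p by (auto simp: unit_inv_sq_def prime_dvd_mult_iff power_mult_distrib)
  have inj: "inj_on (\<lambda>k. 2 * k mod ?Q) {..<?Q}"
  proof (rule inj_onI)
    fix k l assume kl: "k \<in> {..<?Q}" "l \<in> {..<?Q}" "2 * k mod ?Q = 2 * l mod ?Q"
    then have "[2 * k = 2 * l] (mod ?Q)" by (simp add: cong_def)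
    then have "[k = l] (mod ?Q)" using cop by (simp add: cong_mult_lcancel_nat)
    then show "k = l" using kl by (simp add: cong_def)
  qed
  have "(\<lambda>k. 2 * k mod ?Q) ` {..<?Q} \<subseteq> {..<?Q}" using Q by auto
  then have "bij_betw (\<lambda>k. 2 * k mod ?Q) {..<?Q} {..<?Q}"
    using inj by (simp add: bij_betw_def endo_inj_surj)
  then have s: "?s = (\<Sum>k<?Q. ?u (2 * k mod ?Q))"
    unfolding plain_sum_def by (rule sum.reindex_bij_betw[symmetric])
  have "[(\<Sum>k<?Q. ?u (2 * k mod ?Q)) = (\<Sum>k<?Q. ?u (2 * k))] (mod_p^j)"
    using assms by (intro padic_cong_sum unit_inv_sq_cong) (auto simp: cong_def)
  then have 1: "[?s = 1 / 4 * ?s] (mod_p^j)"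
    unfolding s[symmetric] u2 by (simp add: plain_sum_def sum_distrib_left)
  have "1 / 3 \<in> (padic_Ints :: 'p padic set)"
    using padic_Ints_inverse_of_nat[OF p3] by simp
  then have "[4 / 3 * (?s - 1 / 4 * ?s) = 4 / 3 * (1 / 4 * ?s - 1 / 4 * ?s)] (mod_p^j)"
    using 1 padic_Ints_closed(8)[of 4 "1 / 3 :: 'p padic"]
    by (intro padic_cong_mult padic_cong_diff padic_cong_refl) (auto simp: padic_cong_def)
  then show ?thesis by (simp add: algebra_simps)
qed

lemma plain_sum_periodic_step:
  assumes "CARD('p) > 3" "j > 0"
  shows "[plain_sum (m + CARD('p) ^ j) = (plain_sum m :: 'p::prime_card padic)] (mod_p^j)"
proof (induction m)
  case 0
  then show ?case using plain_sum_period_0[OF assms] by (simp add: plain_sum_def[of 0])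
next
  case (Suc m)
  have "[unit_inv_sq (m + CARD('p) ^ j) = (unit_inv_sq m :: 'p padic)] (mod_p^j)"
    using assms by (intro unit_inv_sq_cong) (auto simp: cong_def)
  then show ?case
    using padic_cong_add[OF Suc] by (simp add: plain_sum_Suc)
qed

lemma plain_sum_periodic:
  assumes "CARD('p) > 3" "j > 0"
  shows "[plain_sum (m + CARD('p) ^ j * t) = (plain_sum m :: 'p::prime_card padic)] (mod_p^j)"
proof (induction t)
  case (Suc t)
  then show ?case
    using padic_cong_trans[OF plain_sum_periodic_step[OF assms, of "m + CARD('p) ^ j * t"]]
    by (simp add: algebra_simps)
qed simp

lemma sum_lessThan_add: "(\<Sum>k<m + n. f k) = (\<Sum>k<m. f k) + (\<Sum>k<n. f (m + k))"
  for f :: "nat \<Rightarrow> 'a::comm_monoid_add"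
  by (induction n) (auto simp: add.assoc)

text \<open>A shift by the odd number p^j preserves \<open>unit_inv_sq\<close> modulo p^j but flips
  the sign, so the two halves cancel. Hence the period is 2 p^j.\<close>

lemma alt_sum_period_0:
  assumes "odd (CARD('p))" "j > 0"
  shows "[alt_sum (2 * CARD('p) ^ j) = (0 :: 'p::prime_card padic)] (mod_p^j)"
proof -
  let ?Q = "CARD('p) ^ j"
  let ?u = "unit_inv_sq :: nat \<Rightarrow> 'p padic"
  have sign: "(- 1) ^ k \<in> (padic_Ints :: 'p padic set)" for k by auto
  have "alt_sum (2 * ?Q) = (\<Sum>k<?Q + ?Q. (- 1) ^ k * ?u k)"
    by (simp add: alt_sum_def power_add mult_2[symmetric])
  also have "\<dots> = (\<Sum>k<?Q. (- 1) ^ k * (?u k - ?u (?Q + k)))"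
    unfolding sum_lessThan_add using assms
    by (simp add: power_add sum.distrib[symmetric] sum_negf sum_subtractf right_diff_distrib)
  finally have *: "alt_sum (2 * ?Q) = (\<Sum>k<?Q. (- 1) ^ k * (?u k - ?u (?Q + k)))" .
  have "[(- 1) ^ k * (?u k - ?u (?Q + k)) = (- 1) ^ k * (?u k - ?u k)] (mod_p^j)" for k
    using assms by (intro padic_cong_mult padic_cong_diff padic_cong_refl unit_inv_sq_cong)
      (auto simp: cong_def)
  then have "[(\<Sum>k<?Q. (- 1) ^ k * (?u k - ?u (?Q + k))) = (\<Sum>k<?Q. (- 1) ^ k * (?u k - ?u k))] (mod_p^j)"
    by (rule padic_cong_sum)
  then show ?thesis by (simp add: *)
qed

lemma alt_sum_periodic_step:
  assumes "odd (CARD('p))" "j > 0"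
  shows "[alt_sum (m + 2 * CARD('p) ^ j) = (alt_sum m :: 'p::prime_card padic)] (mod_p^j)"
proof (induction m)
  case 0
  then show ?case using alt_sum_period_0[OF assms] by (simp add: alt_sum_def[of 0])
next
  case (Suc m)
  have "[unit_inv_sq (m + 2 * CARD('p) ^ j) = (unit_inv_sq m :: 'p padic)] (mod_p^j)"
    using assms by (intro unit_inv_sq_cong) (auto simp: cong_def)
  then show ?case
    using padic_cong_diff[OF padic_cong_uminus[OF Suc]] by (simp add: alt_sum_Suc)
qed

lemma alt_sum_periodic:
  assumes "odd (CARD('p))" "j > 0"
  shows "[alt_sum (m + 2 * CARD('p) ^ j * t) = (alt_sum m :: 'p::prime_card padic)] (mod_p^j)"
proof (induction t)
  case (Suc t)
  then show ?case
    using padic_cong_trans[OF alt_sum_periodic_step[OF assms, of "m + 2 * CARD('p) ^ j * t"]]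
    by (simp add: algebra_simps)
qed simp


section \<open>The congruences at natural numbers\<close>

lemma bernoulli_poly_Suc_of_nat:
  "bernoulli_poly n (of_nat (Suc m) :: 'a::field_char_0)
    = bernoulli_poly n (of_nat m) + of_nat n * of_nat m ^ (n - 1)"
proof -
  have "bernoulli_poly n (of_nat (Suc m) :: rat)
      = bernoulli_poly n (of_nat m) + of_nat n * of_nat m ^ (n - 1)"
    using bernoulli_poly_add_1[of n "of_nat m"] by (simp add: algebra_simps)
  from arg_cong[OF this, of "of_rat :: rat \<Rightarrow> 'a"] show ?thesis
    by (simp only: of_rat_add of_rat_mult of_rat_power of_rat_of_nat_eq bernoulli_poly_of_rat[symmetric])
qed

lemma euler_poly_Suc_of_nat:
  "euler_poly n (of_nat (Suc m) :: 'a::field_char_0)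
    = 2 * of_nat m ^ n - euler_poly n (of_nat m)"
proof -
  \<comment> \<open>The constant is written \<open>of_nat 2\<close> so that
    \<open>of_rat_of_nat_eq\<close> also carries it over.\<close>
  have "euler_poly n (of_nat (Suc m) :: rat) = of_nat 2 * of_nat m ^ n - euler_poly n (of_nat m)"
    using euler_poly_add_1[of n "of_nat m"] by (simp add: algebra_simps)
  from arg_cong[OF this, of "of_rat :: rat \<Rightarrow> 'a"] show ?thesis
    by (simp only: of_rat_diff of_rat_mult of_rat_power of_rat_of_nat_eq euler_poly_of_rat[symmetric])
      simp
qed

text \<open>For \<open>m\<close> prime to p, Euler's theorem makes the exponent \<open>e\<close> act
  as -2; for multiples of p, \<open>j \<le> e\<close> makes the power vanish modulo p^j.\<close>

lemma unit_inv_sq_cong_power: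
  assumes "e + 2 = totient (CARD('p) ^ j)" "j \<le> e"
  shows "[of_nat m ^ e = (unit_inv_sq m :: 'p::prime_card padic)] (mod_p^j)"
proof (cases "CARD('p) dvd m")
  case True
  then obtain q where q: "m = CARD('p) * q" ..
  have "(of_nat m :: 'p padic) ^ e - 0 = of_nat CARD('p) ^ (j + (e - j)) * of_nat q ^ e"
    using assms(2) by (simp add: q power_mult_distrib)
  also have "\<dots> = of_nat CARD('p) ^ j * (of_nat CARD('p) ^ (e - j) * of_nat q ^ e)"
    by (simp only: power_add mult.assoc)
  finally show ?thesis
    using True by (intro padic_congI) (auto simp: unit_inv_sq_def)
next
  case False
  then have "coprime m (CARD('p) ^ j)"
    using prime_imp_coprime[OF prime_card[where 'a='p]] by (simp add: coprime_commute)
  then have "[m ^ totient (CARD('p) ^ j) = 1] (mod CARD('p) ^ j)"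
    by (rule euler_theorem)
  then have "[of_nat (m ^ (e + 2)) = (of_nat 1 :: 'p padic)] (mod_p^j)"
    unfolding assms(1) by (rule padic_cong_of_nat)
  then have "[1 / of_nat m ^ 2 * of_nat (m ^ (e + 2)) = 1 / of_nat m ^ 2 * (of_nat 1 :: 'p padic)] (mod_p^j)"
    using False by (intro padic_cong_mult padic_cong_refl padic_Ints_inverse_square)
  moreover have "1 / of_nat m ^ 2 * of_nat (m ^ (e + 2)) = (of_nat m ^ e :: 'p padic)"
    using False by (auto simp: power2_eq_square intro!: gr0I)
  ultimately show ?thesis
    using False by (simp add: unit_inv_sq_def)
qed

text \<open>Both sides vanish at 1 and, modulo p^2, satisfy s(x + 1) = - s(x) - 2
  \<open>unit_inv_sq\<close> x.\<close>

lemma harm2_sum_cong_alt_sum: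
  "[harm2_sum (CARD('p) - 1) (of_nat (Suc m)) = 2 * (alt_sum (Suc m) :: 'p::prime_card padic)] (mod_p^2)"
proof (induction m)
  case 0
  then show ?case by simp
next
  case (Suc m)
  have "harm2_sum (CARD('p) - 1) (of_nat (Suc (Suc m)) :: 'p padic)
      = harm2_defect (CARD('p) - 1) (of_nat (Suc m)) - harm2_sum (CARD('p) - 1) (of_nat (Suc m))"
    using harm2_sum_add_1[of "CARD('p) - 1" "of_nat (Suc m) :: 'p padic"]
    by (simp add: algebra_simps)
  then show ?case
    using padic_cong_add[OF padic_cong_uminus[OF Suc] harm2_defect_cong[of "Suc m"]]
    by (simp add: alt_sum_Suc[of "Suc m"] del: of_nat_Suc)
qed

lemma harm2_odd_sum_cong_plain_sum:
  "[harm2_odd_sum (CARD('p) - 1) (of_nat (Suc m)) = - 2 * (plain_sum (Suc m) :: 'p::prime_card padic)] (mod_p^2)"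
proof (induction m)
  case 0
  then show ?case by simp
next
  case (Suc m)
  have "harm2_odd_sum (CARD('p) - 1) (of_nat (Suc (Suc m)) :: 'p padic)
      = harm2_odd_sum (CARD('p) - 1) (of_nat (Suc m)) + harm2_defect (CARD('p) - 1) (of_nat (Suc m))"
    using harm2_odd_sum_add_1[of "CARD('p) - 1" "of_nat (Suc m) :: 'p padic"]
    by (simp add: algebra_simps)
  then show ?case
    using padic_cong_add[OF Suc harm2_defect_cong[of "Suc m"]]
    by (simp add: plain_sum_Suc[of "Suc m"] algebra_simps)
qed

text \<open>Exponent and modulus are kept abstract to serve both p^2 - p - 2 modulo p^2 and p - 3
  modulo p.\<close>

lemma alt_sum_cong_euler_poly:
  assumes "even n" "n > 0"
    and "\<And>m. [of_nat m ^ n = (unit_inv_sq m :: 'p::prime_card padic)] (mod_p^j)"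
  shows "[2 * alt_sum (Suc m) = - euler_poly n (of_nat (Suc m) :: 'p padic)] (mod_p^j)"
proof (induction m)
  case 0
  have "euler_poly n (1 :: 'p padic) = 0"
    using euler_poly_of_rat[of n 1, where 'a="'p padic"] euler_poly_1_even[OF assms(1,2)] by simp
  then show ?case by simp
next
  case (Suc m)
  have "[- (2 * alt_sum (Suc m)) - 2 * unit_inv_sq (Suc m)
      = - (- euler_poly n (of_nat (Suc m) :: 'p padic)) - 2 * of_nat (Suc m) ^ n] (mod_p^j)"
    by (intro padic_cong_diff padic_cong_uminus Suc padic_cong_mult padic_cong_refl
        padic_cong_sym[OF assms(3)]) auto
  then show ?case
    by (simp add: alt_sum_Suc[of "Suc m"] euler_poly_Suc_of_nat[of n "Suc m"] algebra_simps
        del: of_nat_Suc)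
qed

text \<open>The factor \<open>c\<close> is to satisfy c n = -2 modulo p^j, compensating the factor
  \<open>n\<close> in the Bernoulli difference equation.\<close>

lemma plain_sum_cong_bernoulli_poly:
  assumes "odd n" "n \<noteq> 1"
    and "\<And>m. [c * of_nat n * of_nat m ^ (n - 1) = - 2 * (unit_inv_sq m :: 'p::prime_card padic)] (mod_p^j)"
  shows "[- 2 * plain_sum (Suc m) = c * bernoulli_poly n (of_nat (Suc m) :: 'p padic)] (mod_p^j)"
proof (induction m)
  case 0
  have "bernoulli_poly n (1 :: 'p padic) = 0"
    using bernoulli_poly_of_rat[of n 1, where 'a="'p padic"] bernoulli_poly_1_odd[OF assms(1,2)] by simp
  then show ?case by simp
next
  case (Suc m)
  have "[- 2 * plain_sum (Suc m) + - 2 * unit_inv_sq (Suc m)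
      = c * bernoulli_poly n (of_nat (Suc m) :: 'p padic) + c * of_nat n * of_nat (Suc m) ^ (n - 1)] (mod_p^j)"
    by (intro padic_cong_add Suc padic_cong_sym[OF assms(3)])
  then show ?case
    by (simp add: plain_sum_Suc[of "Suc m"] bernoulli_poly_Suc_of_nat[of n "Suc m"] algebra_simps
        del: of_nat_Suc)
qed


section \<open>Extension to p-adic integers\<close>

text \<open>The approximants stay in a progression of step 2 p^j, a common period of
  \<open>alt_sum\<close> and \<open>plain_sum\<close> modulo p^j when p > 3 and j > 0.\<close>

lemma padic_even_approx:
  fixes a :: "'p::prime_card padic"
  assumes "[a = of_nat m] (mod_p^j)" "odd (CARD('p))"
  obtains t where "[of_nat (m + 2 * CARD('p) ^ j * t) = a] (mod_p^n)"
proof -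
  let ?p = "of_nat CARD('p) :: 'p padic"
  obtain z where z: "z \<in> padic_Ints" "a = of_nat m + ?p ^ j * z"
    using assms(1) by (rule padic_congE)
  obtain r y where r: "y \<in> padic_Ints" "z - of_nat r = ?p ^ n * y"
    using z(1) by (rule padic_Ints_approx)
  have "\<exists>t y'. y' \<in> padic_Ints \<and> z - of_nat (2 * t) = ?p ^ n * y'"
  proof (cases "even r")
    case True
    then obtain t where "r = 2 * t" ..
    then show ?thesis using r by blast
  next
    case False
    \<comment> \<open>Adding the odd number p^n corrects the parity without changing the class
      modulo p^n.\<close>
    then have "even (r + CARD('p) ^ n)" using assms(2) by simp
    then obtain t where t: "r + CARD('p) ^ n = 2 * t" ..
    have "z - of_nat (2 * t) = ?p ^ n * (y - 1)"
      using r(2) unfolding t[symmetric] by (simp add: algebra_simps)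
    then show ?thesis using r(1) by blast
  qed
  then obtain t y' where t: "y' \<in> padic_Ints" "z - of_nat (2 * t) = ?p ^ n * y'"
    by blast
  have "z = of_nat (2 * t) + ?p ^ n * y'"
    using t(2) by (simp add: algebra_simps)
  then have "a - of_nat (m + 2 * CARD('p) ^ j * t) = ?p ^ n * (?p ^ j * y')"
    using z(2) by (simp add: algebra_simps)
  then have "[a = of_nat (m + 2 * CARD('p) ^ j * t)] (mod_p^n)"
    using t(1) by (intro padic_congI) auto
  then show ?thesis
    using that padic_cong_sym by blast
qed

text \<open>A point of the progression close enough to \<open>a\<close> changes \<open>F\<close> and
  \<open>G\<close> only by multiples of p^i; integrality of both values at \<open>a\<close> is
  inherited from that point.\<close>

lemma padic_cong_by_density:
  fixes a :: "'p::prime_card padic"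
  assumes "[a = of_nat m] (mod_p^j)" "odd (CARD('p))"
    and "padic_continuous F a" "padic_continuous G a"
    and FG: "\<And>t. [F (of_nat (m + 2 * CARD('p) ^ j * t)) = G (of_nat (m + 2 * CARD('p) ^ j * t))] (mod_p^i)"
  shows "[F a = G a] (mod_p^i)"
proof -
  let ?p = "of_nat CARD('p) :: 'p padic"
  obtain k l where
    k: "\<And>b. [b = a] (mod_p^k) \<Longrightarrow> \<exists>z\<in>padic_Ints. F b - F a = ?p ^ i * z" and
    l: "\<And>b. [b = a] (mod_p^l) \<Longrightarrow> \<exists>z\<in>padic_Ints. G b - G a = ?p ^ i * z"
    using assms(3,4) unfolding padic_continuous_def by metis
  obtain t where t: "[of_nat (m + 2 * CARD('p) ^ j * t) = a] (mod_p^max k l)"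
    using assms(1,2) by (rule padic_even_approx)
  define b where "b = (of_nat (m + 2 * CARD('p) ^ j * t) :: 'p padic)"
  have b: "[b = a] (mod_p^max k l)" using t by (simp only: b_def)
  have Fb: "[F b = G b] (mod_p^i)" unfolding b_def by (rule FG)
  obtain u v where uv: "u \<in> padic_Ints" "F b - F a = ?p ^ i * u"
    "v \<in> padic_Ints" "G b - G a = ?p ^ i * v"
    using k l padic_cong_weaken[OF b] by (meson max.cobounded1 max.cobounded2)
  have Ints: "F b \<in> padic_Ints" "G b \<in> padic_Ints"
    using Fb by (simp_all add: padic_cong_def)
  have eq: "F a - F b = ?p ^ i * (- u)" "G a - G b = ?p ^ i * (- v)"
    using uv by (simp_all add: algebra_simps)
  have "[F a = F b] (mod_p^i)"
    using Ints(1) padic_Ints_closed(5)[OF uv(1)] eq(1) by (rule padic_congI)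
  moreover have "[G a = G b] (mod_p^i)"
    using Ints(2) padic_Ints_closed(5)[OF uv(3)] eq(2) by (rule padic_congI)
  ultimately show ?thesis
    using Fb padic_cong_trans padic_cong_sym by blast
qed

section \<open>Continuity of the polynomial expressions in \<open>a\<close>\<close>

lemma padic_continuous_harm2_sum: "padic_continuous (harm2_sum n) a"
  unfolding harm2_sum_def gbinomial_pair_def by (intro padic_continuous_intros)

lemma padic_continuous_harm2_odd_sum: "padic_continuous (harm2_odd_sum n) a"
  unfolding harm2_odd_sum_def gbinomial_pair_def by (intro padic_continuous_intros)

lemma padic_continuous_euler_poly: "padic_continuous (euler_poly n) a"
  unfolding euler_poly_def by (intro padic_continuous_intros)

lemma padic_continuous_bernoulli_poly: "padic_continuous (bernoulli_poly n) a"
  unfolding bernoulli_poly_def by (intro padic_continuous_intros)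

theorem theorem1p2:
  fixes p :: nat and a :: "'p::prime_card padic"
  assumes "prime p" and "p = CARD('p)" and "p > 3" and "a \<in> padic_Ints"
  shows
    "(\<forall>m::nat. m > 0 \<and> [a = of_nat m] (mod_p^2) \<longrightarrow>
       [(\<Sum>k=0..p-1. ((- a) gchoose k) * ((a - 1) gchoose k) * harm2 k)
          = 2 * (\<Sum>k | 0 < k \<and> k < m \<and> \<not> p dvd k. (- 1) ^ (m - k) / of_nat k ^ 2)] (mod_p^2)
     \<and> [2 * (\<Sum>k | 0 < k \<and> k < m \<and> \<not> p dvd k. (- 1) ^ (m - k) / of_nat k ^ 2)
          = - euler_poly (p^2 - p - 2) a] (mod_p^2)
     \<and> [(2 * a - 1) * (\<Sum>k=0..p-1. ((- a) gchoose k) * ((a - 1) gchoose k)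
                                      * (harm2 k / (2 * of_nat k + 1)))
          = - 2 * (\<Sum>k | 0 < k \<and> k < m \<and> \<not> p dvd k. 1 / of_nat k ^ 2)] (mod_p^2)
     \<and> [- 2 * (\<Sum>k | 0 < k \<and> k < m \<and> \<not> p dvd k. 1 / of_nat k ^ 2)
          = (2 - 2 * of_nat p) * bernoulli_poly (p^2 - p - 1) a] (mod_p^2))
   \<and> [(\<Sum>k=0..p-1. ((- a) gchoose k) * ((a - 1) gchoose k) * harm2 k)
          = - euler_poly (p - 3) a] (mod_p^1)
   \<and> [(2 * a - 1) * (\<Sum>k=0..p-1. ((- a) gchoose k) * ((a - 1) gchoose k)
                                      * (harm2 k / (2 * of_nat k + 1)))
          = bernoulli_poly (p - 2) a] (mod_p^1)"
proof -
  note p_eq = assms(2)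
  let ?p = "of_nat p :: 'p padic"
  let ?c = "2 - 2 * ?p"
  have odd_p: "odd p"
    using assms(1,3) prime_odd_nat by simp
  then have odd: "odd (CARD('p))" and gt: "CARD('p) > 3"
    using assms(3) unfolding p_eq by blast+
  \<comment> \<open>Thus p is at least 5, and the bound on p^2 makes the subtractions in the indices
    genuine.\<close>
  have "p \<noteq> 4" using odd_p by (metis even_numeral)
  then have "p * p \<ge> 5 * p"
    using assms(3) by (intro mult_right_mono) linarith+
  then have pp: "p ^ 2 \<ge> 5 * p" by (simp add: power2_eq_square)
  have S: "(\<Sum>k=0..p-1. ((- a) gchoose k) * ((a - 1) gchoose k) * harm2 k) = harm2_sum (CARD('p) - 1) a"
    by (simp add: harm2_sum_def gbinomial_pair_def p_eq)
  have T: "(2 * a - 1) * (\<Sum>k=0..p-1. ((- a) gchoose k) * ((a - 1) gchoose k)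
      * (harm2 k / (2 * of_nat k + 1))) = harm2_odd_sum (CARD('p) - 1) a"
    by (simp add: harm2_odd_sum_def gbinomial_pair_def p_eq)
  \<comment> \<open>The totient of p^2 is p^2 - p, so this exponent stands for -2 modulo
    p^2.\<close>
  have tot2: "p ^ 2 - p - 2 + 2 = totient (CARD('p) ^ 2)"
  proof -
    have "totient (p ^ 2) = p ^ 2 - p"
      using totient_prime_power[OF assms(1), of 2]
      by (simp add: power2_eq_square right_diff_distrib')
    then show ?thesis
      unfolding p_eq[symmetric] using pp assms(3) by linarith
  qed
  have pow2: "[of_nat k ^ (p ^ 2 - p - 2) = (unit_inv_sq k :: 'p padic)] (mod_p^2)" for k
    using tot2 by (rule unit_inv_sq_cong_power) (use pp assms(3) in linarith)
  have tot1: "p - 3 + 2 = totient (CARD('p) ^ 1)"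
    using totient_prime[OF assms(1)] assms(3) by (simp add: p_eq[symmetric])
  have pow1: "[of_nat k ^ (p - 3) = (unit_inv_sq k :: 'p padic)] (mod_p^1)" for k
    using tot1 by (rule unit_inv_sq_cong_power) (use assms(3) in linarith)
  have even2: "even (p ^ 2 - p - 2)" "p ^ 2 - p - 2 > 0"
    using odd_p pp assms(3) by auto
  have even1: "even (p - 3)" "p - 3 > 0"
    using odd_p assms(3) by auto
  \<comment> \<open>The Bernoulli index exceeds the exponent by one because its difference equation
    lowers the degree.\<close>
  have n2: "p ^ 2 - p - 1 = Suc (p ^ 2 - p - 2)" and n1: "p - 2 = Suc (p - 3)"
    using pp assms(3) by linarith+
  have euler2: "[2 * alt_sum (Suc k) = - euler_poly (p ^ 2 - p - 2) (of_nat (Suc k) :: 'p padic)] (mod_p^2)" for k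
    using even2 pow2 by (rule alt_sum_cong_euler_poly)
  have euler1: "[2 * alt_sum (Suc k) = - euler_poly (p - 3) (of_nat (Suc k) :: 'p padic)] (mod_p^1)" for k
    using even1 pow1 by (rule alt_sum_cong_euler_poly)
  have bern2: "[- 2 * plain_sum (Suc k) = ?c * bernoulli_poly (p ^ 2 - p - 1) (of_nat (Suc k) :: 'p padic)] (mod_p^2)" for k
  proof (rule plain_sum_cong_bernoulli_poly)
    fix k
    have "p ^ 2 - p - 1 + (p + 1) = p ^ 2" using pp assms(3) by linarith
    then have "(of_nat (p ^ 2 - p - 1 + (p + 1)) :: 'p padic) = of_nat (p ^ 2)"
      by (simp only:)
    then have n: "(of_nat (p ^ 2 - p - 1) :: 'p padic) = ?p ^ 2 - ?p - 1"
      by (simp add: algebra_simps)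
    \<comment> \<open>Modulo p^2 the index is -(1 + p), and (1 - p)(1 + p) is 1; this explains the
      constant 2 - 2p.\<close>
    have "?c * of_nat (p ^ 2 - p - 1) - (- 2) = of_nat CARD('p) ^ 2 * (4 - 2 * ?p)"
      unfolding n p_eq[symmetric] by (simp add: algebra_simps power2_eq_square)
    then have "[?c * of_nat (p ^ 2 - p - 1) = - 2] (mod_p^2)"
      by (intro padic_congI[of _ "4 - 2 * ?p"]) auto
    from padic_cong_mult[OF this pow2]
    show "[?c * of_nat (p ^ 2 - p - 1) * of_nat k ^ (p ^ 2 - p - 1 - 1) = - 2 * (unit_inv_sq k :: 'p padic)] (mod_p^2)"
      by (simp add: n2)
  qed (use even2 n2 in auto)
  have bern1: "[- 2 * plain_sum (Suc k) = bernoulli_poly (p - 2) (of_nat (Suc k) :: 'p padic)] (mod_p^1)" for k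
  proof -
    have "[- 2 * plain_sum (Suc k) = 1 * bernoulli_poly (p - 2) (of_nat (Suc k) :: 'p padic)] (mod_p^1)"
    proof (rule plain_sum_cong_bernoulli_poly)
      fix k
      have "(of_nat (p - 2) :: 'p padic) - (- 2) = of_nat CARD('p) ^ 1 * 1"
        using assms(3) by (simp add: of_nat_diff p_eq[symmetric])
      then have "[1 * of_nat (p - 2) = (- 2 :: 'p padic)] (mod_p^1)"
        by (intro padic_congI[of _ 1]) auto
      from padic_cong_mult[OF this pow1]
      show "[1 * of_nat (p - 2) * of_nat k ^ (p - 2 - 1) = - 2 * (unit_inv_sq k :: 'p padic)] (mod_p^1)"
        by (simp add: n1)
    qed (use even1 n1 in auto)
    then show ?thesis by simp
  qed
  have part1: "[harm2_sum (CARD('p) - 1) a = 2 * alt_sum m] (mod_p^2)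
      \<and> [2 * alt_sum m = - euler_poly (p ^ 2 - p - 2) a] (mod_p^2)
      \<and> [harm2_odd_sum (CARD('p) - 1) a = - 2 * plain_sum m] (mod_p^2)
      \<and> [- 2 * plain_sum m = ?c * bernoulli_poly (p ^ 2 - p - 1) a] (mod_p^2)"
    if m: "m > 0" "[a = of_nat m] (mod_p^2)" for m
  proof -
    \<comment> \<open>The congruences at naturals are stated for successors; positivity of
      \<open>m\<close> makes every point of the progression one.\<close>
    have Suc: "m + 2 * CARD('p) ^ 2 * t = Suc (m + 2 * CARD('p) ^ 2 * t - 1)" for t
      using m(1) by simp
    have S: "[harm2_sum (CARD('p) - 1) (of_nat (m + 2 * CARD('p) ^ 2 * t))
        = 2 * (alt_sum (m + 2 * CARD('p) ^ 2 * t) :: 'p padic)] (mod_p^2)" for t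
      by (subst (1 2) Suc) (rule harm2_sum_cong_alt_sum)
    have E: "[2 * alt_sum (m + 2 * CARD('p) ^ 2 * t)
        = - euler_poly (p ^ 2 - p - 2) (of_nat (m + 2 * CARD('p) ^ 2 * t) :: 'p padic)] (mod_p^2)" for t
      by (subst (1 2) Suc) (rule euler2)
    have T: "[harm2_odd_sum (CARD('p) - 1) (of_nat (m + 2 * CARD('p) ^ 2 * t))
        = - 2 * (plain_sum (m + 2 * CARD('p) ^ 2 * t) :: 'p padic)] (mod_p^2)" for t
      by (subst (1 2) Suc) (rule harm2_odd_sum_cong_plain_sum)
    have B: "[- 2 * plain_sum (m + 2 * CARD('p) ^ 2 * t)
        = ?c * bernoulli_poly (p ^ 2 - p - 1) (of_nat (m + 2 * CARD('p) ^ 2 * t) :: 'p padic)] (mod_p^2)" for t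
      by (subst (1 2) Suc) (rule bern2)
    \<comment> \<open>Along the progression both sums are constant modulo p^2, so they enter the
      density argument as constant functions.\<close>
    have alt: "[2 * alt_sum (m + 2 * CARD('p) ^ 2 * t) = 2 * (alt_sum m :: 'p padic)] (mod_p^2)" for t
      using odd by (intro padic_cong_mult alt_sum_periodic padic_cong_refl) auto
    have plain: "[- 2 * plain_sum (m + 2 * CARD('p) ^ 2 * t) = - 2 * (plain_sum m :: 'p padic)] (mod_p^2)" for t
      using plain_sum_periodic[OF gt, of 2 m "2 * t"]
      by (intro padic_cong_mult padic_cong_refl) (auto simp: mult_ac)
    show ?thesis
    proof (intro conjI)
      show "[harm2_sum (CARD('p) - 1) a = 2 * alt_sum m] (mod_p^2)"
        by (rule padic_cong_by_density[OF m(2) odd padic_continuous_harm2_sum padic_continuous_const])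
          (rule padic_cong_trans[OF S alt])
      show "[2 * alt_sum m = - euler_poly (p ^ 2 - p - 2) a] (mod_p^2)"
        by (rule padic_cong_by_density[OF m(2) odd padic_continuous_const
              padic_continuous_uminus[OF padic_continuous_euler_poly]])
          (rule padic_cong_trans[OF padic_cong_sym[OF alt] E])
      show "[harm2_odd_sum (CARD('p) - 1) a = - 2 * plain_sum m] (mod_p^2)"
        by (rule padic_cong_by_density[OF m(2) odd padic_continuous_harm2_odd_sum padic_continuous_const])
          (rule padic_cong_trans[OF T plain])
      show "[- 2 * plain_sum m = ?c * bernoulli_poly (p ^ 2 - p - 1) a] (mod_p^2)"
        by (rule padic_cong_by_density[OF m(2) odd padic_continuous_const
              padic_continuous_mult[OF padic_continuous_const padic_continuous_bernoulli_poly]])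
          (rule padic_cong_trans[OF padic_cong_sym[OF plain] B])
    qed
  qed
  obtain k z where kz: "z \<in> padic_Ints" "a - of_nat k = of_nat CARD('p) ^ 1 * z"
    using assms(4) by (rule padic_Ints_approx)
  \<comment> \<open>The approximant \<open>k\<close> may be 0; adding p keeps its class modulo p and
    makes it a successor.\<close>
  have "a - of_nat (Suc (k + (CARD('p) - 1))) = of_nat CARD('p) ^ 1 * (z - 1)"
    using kz(2) gt by (simp add: algebra_simps of_nat_diff)
  then have m: "[a = of_nat (Suc (k + (CARD('p) - 1)))] (mod_p^1)"
    using kz(1) by (intro padic_congI[of _ "z - 1"] padic_Ints_closed)
  \<comment> \<open>Both sides now vary with \<open>a\<close>: they agree modulo p at positive
    integers through \<open>alt_sum\<close>, and density carries this to \<open>a\<close>.\<close>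
  have "[harm2_sum (CARD('p) - 1) a = - euler_poly (p - 3) a] (mod_p^1)"
    by (rule padic_cong_by_density[OF m odd padic_continuous_harm2_sum
          padic_continuous_uminus[OF padic_continuous_euler_poly]])
      (unfold add_Suc, rule padic_cong_trans[OF padic_cong_weaken[OF harm2_sum_cong_alt_sum] euler1], simp)
  moreover have "[harm2_odd_sum (CARD('p) - 1) a = bernoulli_poly (p - 2) a] (mod_p^1)"
    by (rule padic_cong_by_density[OF m odd padic_continuous_harm2_odd_sum padic_continuous_bernoulli_poly])
      (unfold add_Suc, rule padic_cong_trans[OF padic_cong_weaken[OF harm2_odd_sum_cong_plain_sum] bern1], simp)
  ultimately show ?thesis
    using part1 unfolding S T unfolding p_eq alt_sum_conv plain_sum_conv by blast
qed

end
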